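(* Let $n\ge1$ and $N\ge n$ be integers, let $r\ge 1$ be real, and let $C\subset\mathbb{R}^N$ be a centrally symmetric convex body with the origin as an interior point. Let $(K_t)_{t\in[-1,1]}$ be an RS-movement in $\mathbb{R}^n$, where each $K_t$ is a centrally symmetric convex body with the origin as an interior point. Then $$t\longmapsto W_r(K_t;N;C)$$ is a convex function of $t$.
   Context: A convex body is a compact convex set with non-empty interior; a set $K$ is centrally symmetric if $K=-K$. $|\cdot|$ denotes Lebesgue measure on $\mathbb{R}^n$ and $\operatorname{conv}$ denotes convex hull. For a set $L\subset\mathbb{R}^n$, the polar is $L^{\circ}=\{\omega\in\mathbb{R}^n:\langle\omega,x\rangle\le 1\ \forall x\in L\}$. For $x_1,\dots,x_N\in\mathbb{R}^n$ and $C\subset\mathbb{R}^N$, $[x_1\cdots x_N]C=\{\sum_{i=1}^N c_ix_i : (c_1,\dots,c_N)\in C\}\subset\mathbb{R}^n$. For centrally symmetric convex bodies $K\subset\mathbb{R}^n$ and $C\subset\mathbb{R}^N$ with the origin as an interior point, $r\ge1$ and $N\ge n$, $$W_r(K;N;C)=\frac{1}{|K|^{N+r}}\int_{K^N}\bigl|([x_1\cdots x_N]C)^{\circ}\bigr|^{-r}\,dx_1\cdots dx_N.$$ Equivalently, $W_r(K;N;C)=|K|^{-r}\,\mathbb{E}\,|([X_1\cdots X_N]C)^{\circ}|^{-r}$ with $X_1,\dots,X_N$ independent random vectors uniformly distributed in $K$. Shadow system: a shadow system along a direction $\theta\in\mathbb{S}^{n-1}$ (the unit sphere of $\mathbb{R}^n$)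 is a family of convex sets $K_t=\operatorname{conv}\{x+t\alpha(x)\theta : x\in A\}\subset\mathbb{R}^n$, where $A\subset\mathbb{R}^n$ is an arbitrary bounded set, $\alpha$ is a bounded function on $A$, and $t$ belongs to an interval of the real axis. RS-movement: let $K\subset\mathbb{R}^n$ and let $P$ be the orthogonal projection onto $\theta^{\perp}$. A shadow system is called an RS-movement of $K$ if $$K_t=\operatorname{conv}\{x+t\beta(Px)\theta : x\in K\},$$ where $t\in[a,b]$, $0\in[a,b]$, and $\beta$ is a real-valued function on $PK$ (so the speed function is constant on each chord of $K$ parallel to $\theta$).
   Formalization: The RS-movement is additionally assumed to move chords up to a null set: for each t in [-1,1], the convex hull K_t exceeds the union of the translated chords of K_0 only by a set of measure zero (equivalently |K_t|=|K_0|); without this the claim is false. *)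

theory Defs
  imports "HOL-Analysis.Analysis"
begin

definition convex_body :: "'a::euclidean_space set \<Rightarrow> bool" where
  "convex_body K \<longleftrightarrow> compact K \<and> convex K \<and> interior K \<noteq> {}"

definition centrally_symmetric :: "'a::real_vector set \<Rightarrow> bool" where
  "centrally_symmetric K \<longleftrightarrow> K = uminus ` K"

definition polar :: "'a::real_inner set \<Rightarrow> 'a set" where
  "polar L = {w. \<forall>x\<in>L. w \<bullet> x \<le> 1}"

definition comb_image :: "('m::finite \<Rightarrow> 'a::real_vector) \<Rightarrow> (real ^ 'm) set \<Rightarrow> 'a set" where
  "comb_image x C = (\<lambda>c. \<Sum>i\<in>UNIV. (c $ i) *\<^sub>R x i) ` C"

text \<open>The polar of the image of \<open>C\<close> has infinite volume as soon as the points do not span the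
  space; the negative power of that volume is then \<open>0\<close>. The case is spelled out because
  \<^const>\<open>measure\<close> sends infinite values to \<open>0\<close>.\<close>

definition vol_neg_powr :: "real \<Rightarrow> 'a::euclidean_space set \<Rightarrow> real" where
  "vol_neg_powr r S =
     (if emeasure lebesgue S = \<infinity> then 0 else measure lebesgue S powr (- r))"

text \<open>The number \<open>N\<close> of points is the cardinality of the index type \<open>'m\<close>, and \<open>N\<close>-tuples of points
  are functions on \<open>'m\<close>.\<close>

definition W :: "real \<Rightarrow> 'a::euclidean_space set \<Rightarrow> (real ^ 'm::finite) set \<Rightarrow> real" where
  "W r K C =
     1 / measure lebesgue K powr (real CARD('m) + r) *
     (LINT x:{x. \<forall>i. x i \<in> K}|(\<Pi>\<^sub>M i\<in>(UNIV :: 'm set). lborel).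
        vol_neg_powr r (polar (comb_image x C)))"

definition shadow_system ::
  "'a::euclidean_space \<Rightarrow> 'a set \<Rightarrow> ('a \<Rightarrow> real) \<Rightarrow> real set \<Rightarrow> (real \<Rightarrow> 'a set) \<Rightarrow> bool" where
  "shadow_system \<theta> A \<alpha> I K \<longleftrightarrow>
     norm \<theta> = 1 \<and> bounded A \<and> bounded (\<alpha> ` A) \<and> is_interval I \<and>
     (\<forall>t\<in>I. K t = convex hull ((\<lambda>x. x + (t * \<alpha> x) *\<^sub>R \<theta>) ` A))"

text \<open>For a unit vector \<open>\<theta>\<close>: the orthogonal projection onto the hyperplane orthogonal to \<open>\<theta>\<close>.\<close>

definition perp_proj :: "'a::real_inner \<Rightarrow> 'a \<Rightarrow> 'a" where
  "perp_proj \<theta> x = x - (x \<bullet> \<theta>) *\<^sub>R \<theta>"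

definition RS_movement ::
  "'a::euclidean_space \<Rightarrow> ('a \<Rightarrow> real) \<Rightarrow> 'a set \<Rightarrow> real \<Rightarrow> real \<Rightarrow> (real \<Rightarrow> 'a set) \<Rightarrow> bool" where
  "RS_movement \<theta> \<beta> L a b K \<longleftrightarrow>
     0 \<in> {a..b} \<and> shadow_system \<theta> L (\<beta> \<circ> perp_proj \<theta>) {a..b} K"

text \<open>The union of the translated chords of \<open>L\<close> parallel to \<open>\<theta>\<close>, before the convex hull is taken.
  For arbitrary \<open>\<beta>\<close> the hull may be larger by a set of positive measure; it then contains chords
  longer than those of \<open>L\<close>, and the volume is not preserved along the movement.\<close>

definition moved_chords ::
  "'a::real_inner \<Rightarrow> ('a \<Rightarrow> real) \<Rightarrow> 'a set \<Rightarrow> real \<Rightarrow> 'a set" where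
  "moved_chords \<theta> \<beta> L t = (\<lambda>x. x + (t * \<beta> (perp_proj \<theta> x)) *\<^sub>R \<theta>) ` L"

end

theory Submission
  imports Defs
begin

text \<open>For fixed points \<open>y\<^sub>l\<close> moving along \<open>\<theta>\<close> with speeds \<open>b\<^sub>l\<close>, the polar of the image of \<open>C\<close> is a
  section of a fixed symmetric convex set one dimension higher, and its
  inverse volume is convex in \<open>t\<close> by an argument like that of Busemann's theorem. In the projective chart \<open>w = (a, 1) / s\<close> the volume becomes
  \<open>c \<cdot> \<integral> G(a, t)\<^bsup>-n\<^esup> da\<close> over \<open>a\<close> in dimension \<open>n - 1\<close>, with \<open>G\<close> jointly convex. Integrating out one
  coordinate of \<open>G\<^bsup>-(k+1)\<^esup>\<close> gives \<open>H\<^bsup>-k\<^esup>\<close> with \<open>H\<close> again convex; this is the one-dimensional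
  Borell-Brascamp-Lieb inequality, and it only uses that the sublevel sets are intervals. After
  \<open>n - 1\<close> steps the inverse volume is convex, hence so is its \<open>r\<close>-th power.

  An RS-movement is, up to null sets, a shear of \<open>K 0\<close> along \<open>\<theta>\<close>; shears preserve Lebesgue measure,
  so the integral defining \<open>W\<close> is pulled back to the fixed domain \<open>K 0\<close>, where the integrand is
  convex in \<open>t\<close> pointwise.\<close>

section \<open>The one-dimensional Borell-Brascamp-Lieb inequality\<close>

text \<open>The inverse volume is carried as a real function \<open>h\<close> with volume equal to
  \<open>inverse (ennreal h)\<close>. The value \<open>h = 0\<close> then stands for infinite
  volume, so tuples that do not span the space need no separate argument. The chart is chosen
  because of \<open>t\<close>. In the section \<open>{v. G (v, t * v $ i) \<le> 1}\<close> the
  parameter multiplies the variable, and convexity in \<open>t\<close> is hidden. Dividing by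
  \<open>v $ i\<close> turns \<open>t\<close> into an ordinary coordinate next to the remaining
  ones, and joint convexity becomes visible. Homogeneity of \<open>G\<close> produces the exponent
  \<open>-n\<close>, and \<open>n - 1\<close> marginals, each costing one power, end at exponent
  \<open>-1\<close>, which is convexity of \<open>h\<close> itself. A marginal costs exactly one
  power because \<open>p ^ (k + 1) / q ^ k\<close> is jointly convex, where \<open>p\<close> is an
  infimum and \<open>q\<close> a power mean. For the movement the obstacle is that
  \<open>\<beta>\<close> is arbitrary: a shear by \<open>\<beta>\<close> need not be measurable, and
  \<open>K t\<close> is known only up to a null set. Hence the speed is replaced by a Borel function
  read off from integrals over chords, which do not see null sets.\<close>

lemma ennreal_inverse_antimono: "a \<le> b \<Longrightarrow> inverse b \<le> inverse (a :: ennreal)"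
  including ennreal.lifting by transfer (rule ereal_inverse_antimono)

lemma inverse_ennreal_power: "0 \<le> x \<Longrightarrow> inverse (ennreal x) ^ n = inverse (ennreal (x ^ n))"
  by (simp add: ennreal_inverse_power[symmetric] ennreal_power)

lemma borel_measurable_convex:
  fixes g :: "'a::euclidean_space \<Rightarrow> real"
  assumes "convex_on UNIV g" shows "g \<in> borel_measurable borel"
  using assms by (intro borel_measurable_continuous_onI convex_on_continuous) auto

text \<open>The left side is the tangent to \<open>x ^ (k + 1)\<close> at \<open>r\<close>. In the
  induction step, multiplying by \<open>x\<close> leaves a gap of \<open>(k + 1) * r ^ k\<close>
  times the square of \<open>r - x\<close>.\<close>

lemma power_tangent_le:
  fixes x r :: real
  assumes "0 \<le> x" "0 \<le> r"
  shows "real (k + 1) * r ^ k * x - real k * r ^ (k + 1) \<le> x ^ (k + 1)"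
proof (induction k)
  case (Suc k)
  have "0 \<le> real (k + 1) * r ^ k * (r - x)\<^sup>2"
    using assms by simp
  moreover have "x * (real (k + 1) * r ^ k * x - real k * r ^ (k + 1)) \<le> x * x ^ (k + 1)"
    using Suc assms by (intro mult_left_mono) auto
  ultimately show ?case
    by (simp add: algebra_simps power2_eq_square)
qed simp

text \<open>The quotient is the perspective of the power function. The tangent at slope
  \<open>r = P / Q\<close> gives a minorant that is linear in the pair of numerator and denominator
  base, with equality at \<open>(P, Q)\<close>.\<close>

lemma power_quotient_convex:
  fixes p0 p1 q0 q1 u :: real
  assumes p: "0 \<le> p0" "0 \<le> p1" and q: "0 < q0" "0 < q1" and u: "0 \<le> u" "u \<le> 1"
  shows "((1 - u) * p0 + u * p1) ^ (k + 1) / ((1 - u) * q0 + u * q1) ^ k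
       \<le> (1 - u) * (p0 ^ (k + 1) / q0 ^ k) + u * (p1 ^ (k + 1) / q1 ^ k)"
proof -
  define P Q where "P = (1 - u) * p0 + u * p1" and "Q = (1 - u) * q0 + u * q1"
  define r where "r = P / Q"
  have Q: "0 < Q"
    unfolding Q_def using q u by (cases "u = 0") (auto intro: add_nonneg_pos)
  have P: "0 \<le> P" unfolding P_def using p u by auto
  have r: "0 \<le> r" "P = r * Q" unfolding r_def using P Q by auto
  have tangent: "real (k + 1) * r ^ k * p - real k * r ^ (k + 1) * q \<le> p ^ (k + 1) / q ^ k"
    if "0 \<le> p" "0 < q" for p q :: real
  proof -
    have "q * (real (k + 1) * r ^ k * (p / q) - real k * r ^ (k + 1)) \<le> q * (p / q) ^ (k + 1)"
      using that r by (intro mult_left_mono power_tangent_le) auto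
    moreover have "q * (real (k + 1) * r ^ k * (p / q) - real k * r ^ (k + 1))
        = real (k + 1) * r ^ k * p - real k * r ^ (k + 1) * q"
      using that by (simp add: right_diff_distrib)
    moreover have "q * (p / q) ^ (k + 1) = p ^ (k + 1) / q ^ k"
      using that by (simp add: power_divide)
    ultimately show ?thesis by linarith
  qed
  have "P ^ (k + 1) / Q ^ k = r ^ k * P"
    using Q r by (simp add: field_simps)
  also have "\<dots> = (1 - u) * (real (k + 1) * r ^ k * p0 - real k * r ^ (k + 1) * q0)
      + u * (real (k + 1) * r ^ k * p1 - real k * r ^ (k + 1) * q1)"
  proof -
    have "(1 - u) * (real (k + 1) * r ^ k * p0 - real k * r ^ (k + 1) * q0)
      + u * (real (k + 1) * r ^ k * p1 - real k * r ^ (k + 1) * q1)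
      = real (k + 1) * r ^ k * P - real k * r ^ (k + 1) * Q"
      unfolding P_def Q_def by (simp add: algebra_simps)
    also have "\<dots> = r ^ k * P" using r(2) by (simp add: algebra_simps)
    finally show ?thesis by simp
  qed
  also have "\<dots> \<le> (1 - u) * (p0 ^ (k + 1) / q0 ^ k) + u * (p1 ^ (k + 1) / q1 ^ k)"
    using tangent p q u by (intro add_mono mult_left_mono) auto
  finally show ?thesis unfolding P_def Q_def .
qed

text \<open>Closed convex sets on the line are intervals, possibly unbounded. Cut down to
  \<open>{- n .. n}\<close> they are compact intervals whose lengths combine linearly, and the bound
  passes to the limit. \<open>D\<close> only has to contain the combination.\<close>

lemma brunn_minkowski_real:
  fixes A B D :: "real set"
  assumes A: "closed A" "convex A" "A \<noteq> {}" and B: "closed B" "convex B" "B \<noteq> {}"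
    and D: "D \<in> sets borel" and u: "0 \<le> u" "u \<le> 1"
    and sub: "\<And>a b. a \<in> A \<Longrightarrow> b \<in> B \<Longrightarrow> (1 - u) * a + u * b \<in> D"
  shows "ennreal (1 - u) * emeasure lborel A + ennreal u * emeasure lborel B \<le> emeasure lborel D"
proof -
  define cut where "cut S n = S \<inter> {- real n .. real n}" for S n
  have lim: "(\<lambda>n. emeasure lborel (cut S n)) \<longlonglongrightarrow> emeasure lborel S" if "closed S" for S
  proof -
    have "(\<Union>n. cut S n) = S"
    proof -
      have "\<exists>n. x \<in> cut S n" if "x \<in> S" for x
      proof -
        obtain n where "\<bar>x\<bar> \<le> real n" using real_arch_simple by blast
        then show ?thesis using that by (intro exI[of _ n]) (auto simp: cut_def)
      qed
      then show ?thesis by (auto simp: cut_def)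
    qed
    moreover have "incseq (cut S)"
      by (auto simp: cut_def incseq_def)
    moreover have "range (cut S) \<subseteq> sets lborel"
      using that by (auto simp: cut_def)
    ultimately show ?thesis
      using Lim_emeasure_incseq[of "cut S" lborel] by simp
  qed
  have interval: "\<exists>l r. l \<le> r \<and> cut S n = {l..r}"
    if "closed S" "convex S" "cut S n \<noteq> {}" for S n
  proof -
    have "compact (cut S n)" "convex (cut S n)"
      using that by (auto simp: cut_def intro: closed_Int_compact convex_Int)
    then have "\<exists>l r. cut S n = {l..r}"
      using connected_compact_interval_1 convex_connected by blast
    then show ?thesis using that by fastforce
  qed
  have bound: "ennreal (1 - u) * emeasure lborel (cut A n) + ennreal u * emeasure lborel (cut B n)
      \<le> emeasure lborel D" if ne: "cut A n \<noteq> {}" "cut B n \<noteq> {}" for n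
  proof -
    obtain l r l' r' where lr: "l \<le> r" "cut A n = {l..r}" "l' \<le> r'" "cut B n = {l'..r'}"
      using interval A B ne by metis
    have "{(1 - u) * l + u * l' .. (1 - u) * r + u * r'} \<subseteq> D"
    proof
      fix x assume x: "x \<in> {(1 - u) * l + u * l' .. (1 - u) * r + u * r'}"
      define d where "d = (1 - u) * r + u * r' - ((1 - u) * l + u * l')"
      have d: "0 \<le> x - ((1 - u) * l + u * l')" "x - ((1 - u) * l + u * l') \<le> d"
        using x by (auto simp: d_def)
      \<comment> \<open>The relative position of \<open>x\<close> in the combined interval: the
        points at the same position in the two intervals combine to \<open>x\<close>. If
        \<open>d = 0\<close>, division by zero gives \<open>s = 0\<close>, which fits as
        well.\<close>
      define s where "s = (x - ((1 - u) * l + u * l')) / d"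
      have s: "0 \<le> s" "s \<le> 1" "x = (1 - u) * l + u * l' + s * d"
        using d by (cases "d = 0"; simp add: s_def)+
      have "l + s * (r - l) \<in> cut A n" "l' + s * (r' - l') \<in> cut B n"
        using s lr mult_left_le_one_le[of "r - l" s] mult_left_le_one_le[of "r' - l'" s] by auto
      then have "(1 - u) * (l + s * (r - l)) + u * (l' + s * (r' - l')) \<in> D"
        by (intro sub) (auto simp: cut_def)
      also have "(1 - u) * (l + s * (r - l)) + u * (l' + s * (r' - l')) = x"
        unfolding s(3) d_def by (simp add: algebra_simps)
      finally show "x \<in> D" .
    qed
    then have "emeasure lborel {(1 - u) * l + u * l' .. (1 - u) * r + u * r'} \<le> emeasure lborel D"
      using D by (intro emeasure_mono) auto
    moreover have "(1 - u) * l + u * l' \<le> (1 - u) * r + u * r'"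
      using lr u by (intro add_mono mult_left_mono) auto
    ultimately have "ennreal ((1 - u) * (r - l) + u * (r' - l')) \<le> emeasure lborel D"
      by (simp add: algebra_simps)
    moreover have "ennreal ((1 - u) * (r - l) + u * (r' - l'))
        = ennreal (1 - u) * emeasure lborel (cut A n) + ennreal u * emeasure lborel (cut B n)"
      using lr u by (simp add: ennreal_plus ennreal_mult)
    ultimately show ?thesis by simp
  qed
  obtain a b where ab: "a \<in> A" "b \<in> B" using A B by blast
  have "\<forall>\<^sub>F n in sequentially. cut A n \<noteq> {} \<and> cut B n \<noteq> {}"
    using eventually_ge_at_top[of "nat \<lceil>max \<bar>a\<bar> \<bar>b\<bar>\<rceil>"]
  proof eventually_elim
    case (elim n)
    then have "max \<bar>a\<bar> \<bar>b\<bar> \<le> real n" by linarith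
    then have "a \<in> cut A n" "b \<in> cut B n" using ab by (auto simp: cut_def)
    then show ?case by blast
  qed
  then have ev: "\<forall>\<^sub>F n in sequentially.
      ennreal (1 - u) * emeasure lborel (cut A n) + ennreal u * emeasure lborel (cut B n) \<le> emeasure lborel D"
    by eventually_elim (use bound in blast)
  have "(\<lambda>n. ennreal (1 - u) * emeasure lborel (cut A n) + ennreal u * emeasure lborel (cut B n))
      \<longlonglongrightarrow> ennreal (1 - u) * emeasure lborel A + ennreal u * emeasure lborel B"
    using A B by (intro tendsto_add ennreal_tendsto_cmult lim) auto
  from tendsto_upperbound[OF this ev] show ?thesis by simp
qed

text \<open>The density is the derivative of \<open>- 1 / s ^ (k + 1)\<close>, which vanishes at
  infinity. With the power written as an integral over levels, Tonelli leaves only lengths of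
  sublevel sets.\<close>

lemma inverse_power_layer_cake:
  fixes g :: real
  assumes "0 < g"
  shows "inverse (ennreal g) ^ (k + 1)
       = (\<integral>\<^sup>+s. ennreal (real (k + 1) / s ^ (k + 2)) * indicator {g..} s \<partial>lborel)"
proof -
  have "((\<lambda>s::real. - 1 / s ^ (k + 1)) \<longlongrightarrow> 0) at_top"
    by (intro real_tendsto_divide_at_top tendsto_const filterlim_pow_at_top filterlim_ident) auto
  moreover have "((\<lambda>s. - 1 / s ^ (k + 1)) has_real_derivative real (k + 1) / s ^ (k + 2)) (at s)"
    if "g \<le> s" for s
  proof -
    have "s \<noteq> 0" using that assms by auto
    then show ?thesis
      by (auto intro!: derivative_eq_intros simp: divide_simps simp flip: power_add power_Suc)
  qed
  ultimately have "(\<integral>\<^sup>+s. ennreal (real (k + 1) / s ^ (k + 2)) * indicator {g..} s \<partial>lborel)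
      = ennreal (0 - (- 1 / g ^ (k + 1)))"
    using assms by (intro nn_integral_FTC_atLeast) auto
  then show ?thesis
    using assms by (simp add: ennreal_power inverse_ennreal inverse_eq_divide power_one_over del: power_Suc)
qed

lemma nn_integral_inverse_power_level_sets:
  fixes f :: "real \<Rightarrow> real"
  assumes f: "f \<in> borel_measurable borel" "\<And>a. 0 < f a"
  shows "(\<integral>\<^sup>+a. inverse (ennreal (f a)) ^ (k + 1) \<partial>lborel)
      = (\<integral>\<^sup>+s. ennreal (real (k + 1) / s ^ (k + 2)) * emeasure lborel {a. f a \<le> s} \<partial>lborel)"
proof -
  note [measurable] = f(1)
  have "(\<integral>\<^sup>+a. inverse (ennreal (f a)) ^ (k + 1) \<partial>lborel)
      = (\<integral>\<^sup>+a. \<integral>\<^sup>+s. ennreal (real (k + 1) / s ^ (k + 2)) * indicator {f a..} s \<partial>lborel \<partial>lborel)"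
    by (simp only: inverse_power_layer_cake f(2))
  also have "\<dots> = (\<integral>\<^sup>+s. \<integral>\<^sup>+a. ennreal (real (k + 1) / s ^ (k + 2)) * indicator {f a..} s \<partial>lborel \<partial>lborel)"
    by (rule lborel_pair.Fubini'[symmetric]) (simp add: indicator_def, measurable)
  also have "\<dots> = (\<integral>\<^sup>+s. ennreal (real (k + 1) / s ^ (k + 2)) * emeasure lborel {a. f a \<le> s} \<partial>lborel)"
  proof (rule nn_integral_cong)
    fix s :: real
    have "(\<integral>\<^sup>+a. ennreal (real (k + 1) / s ^ (k + 2)) * indicator {f a..} s \<partial>lborel)
      = (\<integral>\<^sup>+a. ennreal (real (k + 1) / s ^ (k + 2)) * indicator {a. f a \<le> s} a \<partial>lborel)"
      by (intro nn_integral_cong) (auto simp: indicator_def)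
    also have "\<dots> = ennreal (real (k + 1) / s ^ (k + 2)) * emeasure lborel {a. f a \<le> s}"
      by (subst nn_integral_cmult) (auto simp: nn_integral_indicator)
    finally show "(\<integral>\<^sup>+a. ennreal (real (k + 1) / s ^ (k + 2)) * indicator {f a..} s \<partial>lborel)
      = ennreal (real (k + 1) / s ^ (k + 2)) * emeasure lborel {a. f a \<le> s}" .
  qed
  finally show ?thesis .
qed

text \<open>Both functions are normalised to the infimum 1, so that sublevel sets can be compared at
  the same level: above 1 both are nonempty and the lengths satisfy Brunn-Minkowski, below 1 both
  are empty.\<close>

lemma nn_integral_inverse_power_quasiconvex:
  fixes f0 f1 f :: "real \<Rightarrow> real"
  assumes f0: "convex_on UNIV f0" "\<And>a. 1 \<le> f0 a" "\<And>s. 1 < s \<Longrightarrow> \<exists>a. f0 a \<le> s"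
    and f1: "convex_on UNIV f1" "\<And>a. 1 \<le> f1 a" "\<And>s. 1 < s \<Longrightarrow> \<exists>a. f1 a \<le> s"
    and f: "f \<in> borel_measurable borel" "\<And>a. 0 < f a"
    and u: "0 \<le> u" "u \<le> 1"
    and le: "\<And>s a b. f0 a \<le> s \<Longrightarrow> f1 b \<le> s \<Longrightarrow> f ((1 - u) * a + u * b) \<le> s"
  shows "ennreal (1 - u) * (\<integral>\<^sup>+a. inverse (ennreal (f0 a)) ^ (k + 1) \<partial>lborel)
       + ennreal u * (\<integral>\<^sup>+a. inverse (ennreal (f1 a)) ^ (k + 1) \<partial>lborel)
       \<le> (\<integral>\<^sup>+a. inverse (ennreal (f a)) ^ (k + 1) \<partial>lborel)"
proof -
  have cont: "continuous_on UNIV g" if "convex_on UNIV g" for g :: "real \<Rightarrow> real"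
    using that by (intro convex_on_continuous) auto
  note [measurable] = borel_measurable_convex[OF f0(1)] borel_measurable_convex[OF f1(1)] f(1)
  define w where "w s = ennreal (real (k + 1) / s ^ (k + 2))" for s
  have [measurable]: "w \<in> borel_measurable borel"
    unfolding w_def[abs_def] by measurable
  have level: "convex {a. g a \<le> s}" "closed {a. g a \<le> s}" if "convex_on UNIV g" for g :: "real \<Rightarrow> real" and s
  proof -
    show "convex {a. g a \<le> s}"
      unfolding convex_alt
    proof (intro ballI allI impI)
      fix x y v assume "x \<in> {a. g a \<le> s}" "y \<in> {a. g a \<le> s}" "0 \<le> v \<and> v \<le> (1::real)"
      then have "g ((1 - v) *\<^sub>R x + v *\<^sub>R y) \<le> (1 - v) * g x + v * g y" "(1 - v) * g x + v * g y \<le> s"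
        using convex_onD[OF that, of v x y] by (auto intro: convex_bound_le)
      then show "(1 - v) *\<^sub>R x + v *\<^sub>R y \<in> {a. g a \<le> s}" by simp
    qed
    show "closed {a. g a \<le> s}"
      using cont[OF that] by (intro closed_Collect_le) auto
  qed
  have pos: "0 < f0 a" "0 < f1 a" for a
    using f0(2)[of a] f1(2)[of a] by linarith+
  have [measurable]: "(\<lambda>s. emeasure lborel {a. g a \<le> s}) \<in> borel_measurable borel"
    if [measurable]: "g \<in> borel_measurable borel" for g :: "real \<Rightarrow> real"
  proof -
    have "(\<lambda>s. emeasure lborel {a. g a \<le> s}) = (\<lambda>s. \<integral>\<^sup>+a. indicator {a. g a \<le> s} a \<partial>lborel)"
      by simp
    also have "\<dots> \<in> borel_measurable borel"
      unfolding indicator_def by measurable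
    finally show ?thesis .
  qed
  have "ennreal (1 - u) * (\<integral>\<^sup>+a. inverse (ennreal (f0 a)) ^ (k + 1) \<partial>lborel)
       + ennreal u * (\<integral>\<^sup>+a. inverse (ennreal (f1 a)) ^ (k + 1) \<partial>lborel)
     = (\<integral>\<^sup>+s. w s * (ennreal (1 - u) * emeasure lborel {a. f0 a \<le> s}
         + ennreal u * emeasure lborel {a. f1 a \<le> s}) \<partial>lborel)"
    unfolding nn_integral_inverse_power_level_sets[OF borel_measurable_convex[OF f0(1)] pos(1), where k = k, folded w_def]
      nn_integral_inverse_power_level_sets[OF borel_measurable_convex[OF f1(1)] pos(2), where k = k, folded w_def]
    by (simp add: distrib_left nn_integral_add nn_integral_cmult mult.left_commute[of "w _"])
  also have "\<dots> \<le> (\<integral>\<^sup>+s. w s * emeasure lborel {a. f a \<le> s} \<partial>lborel)"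
  proof (rule nn_integral_mono_AE)
    \<comment> \<open>At the infimum itself one sublevel set may be empty and the other not; this
      single level is discarded.\<close>
    have "AE s in lborel. s \<noteq> (1::real)"
      by (rule AE_lborel_singleton)
    then show "AE s in lborel. w s * (ennreal (1 - u) * emeasure lborel {a. f0 a \<le> s}
         + ennreal u * emeasure lborel {a. f1 a \<le> s}) \<le> w s * emeasure lborel {a. f a \<le> s}"
    proof eventually_elim
      case (elim s)
      show ?case
      proof (cases "1 < s")
        case True
        have "ennreal (1 - u) * emeasure lborel {a. f0 a \<le> s} + ennreal u * emeasure lborel {a. f1 a \<le> s}
            \<le> emeasure lborel {a. f a \<le> s}"
          using level[OF f0(1)] level[OF f1(1)] f0(3)[OF True] f1(3)[OF True] u le
          by (intro brunn_minkowski_real) auto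
        then show ?thesis by (intro mult_left_mono) auto
      next
        case False
        then have "s < 1" using elim by simp
        then have "\<not> f0 a \<le> s" "\<not> f1 a \<le> s" for a
          using f0(2)[of a] f1(2)[of a] by linarith+
        then show ?thesis by simp
      qed
    qed
  qed
  also have "\<dots> = (\<integral>\<^sup>+a. inverse (ennreal (f a)) ^ (k + 1) \<partial>lborel)"
    using f unfolding w_def by (intro nn_integral_inverse_power_level_sets[symmetric])
  finally show ?thesis .
qed

text \<open>Monotone convergence as the shift decreases to 0. A strict lower bound therefore
  survives when \<open>f\<close> is replaced by a function bounded away from 0.\<close>

lemma eventually_less_nn_integral_shift:
  fixes f :: "real \<Rightarrow> real"
  assumes [measurable]: "f \<in> borel_measurable borel" and f: "\<And>a. 0 \<le> f a"
    and c: "c < (\<integral>\<^sup>+a. inverse (ennreal (f a)) ^ m \<partial>lborel)"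
  shows "\<forall>\<^sub>F n in sequentially. c < (\<integral>\<^sup>+a. inverse (ennreal (f a + 1 / Suc n)) ^ m \<partial>lborel)"
proof -
  have "(\<lambda>n. \<integral>\<^sup>+a. inverse (ennreal (f a + 1 / Suc n)) ^ m \<partial>lborel)
      \<longlonglongrightarrow> (\<integral>\<^sup>+a. inverse (ennreal (f a)) ^ m \<partial>lborel)"
  proof (rule nn_integral_LIMSEQ)
    show "incseq (\<lambda>n a. inverse (ennreal (f a + 1 / Suc n)) ^ m)"
    proof (intro incseq_SucI le_funI power_mono)
      fix n a
      show "inverse (ennreal (f a + 1 / real (Suc n))) \<le> inverse (ennreal (f a + 1 / real (Suc (Suc n))))"
        by (intro ennreal_inverse_antimono ennreal_leI add_left_mono divide_left_mono) auto
    qed auto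
    show "(\<lambda>n. inverse (ennreal (f a + 1 / Suc n)) ^ m) \<longlonglongrightarrow> inverse (ennreal (f a)) ^ m" for a
    proof -
      have "(\<lambda>n. f a + 1 / Suc n) \<longlonglongrightarrow> f a + 0"
        by (intro tendsto_add tendsto_const LIMSEQ_Suc[OF lim_1_over_n])
      then have "(\<lambda>n. (f a + 1 / Suc n) ^ m) \<longlonglongrightarrow> f a ^ m"
        by (auto intro: tendsto_power)
      then have "(\<lambda>n. inverse (ennreal ((f a + 1 / Suc n) ^ m))) \<longlonglongrightarrow> inverse (ennreal (f a ^ m))"
        by (intro continuous_on_tendsto_compose[OF continuous_on_inverse_ennreal[OF continuous_on_id],
            where s = UNIV] tendsto_ennrealI) simp_all
      then show ?thesis using f[of a] by (simp add: inverse_ennreal_power del: ennreal_plus)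
    qed
  qed auto
  from order_tendstoD(1)[OF this c] show ?thesis .
qed

text \<open>The functions are divided by their infima, compared level by level, and scaled back.
  Scaling by \<open>p\<close> contributes \<open>p ^ (k + 1)\<close>, and the joint convexity of
  \<open>p ^ (k + 1) / q ^ k\<close> merges the two infima with \<open>q0\<close> and
  \<open>q1\<close>. The bounds on the integrals are strict to leave room for a small shift.\<close>

lemma borell_brascamp_lieb_real:
  fixes g0 g1 g :: "real \<Rightarrow> real"
  assumes g0: "convex_on UNIV g0" "\<And>a. 0 \<le> g0 a" and g1: "convex_on UNIV g1" "\<And>a. 0 \<le> g1 a"
    and g: "g \<in> borel_measurable borel" "\<And>a. 0 \<le> g a"
    and u: "0 \<le> u" "u \<le> 1"
    and le: "\<And>a b. g ((1 - u) * a + u * b) \<le> (1 - u) * g0 a + u * g1 b"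
    and q: "0 < q0" "0 < q1"
    and q0: "inverse (ennreal q0) ^ k < (\<integral>\<^sup>+a. inverse (ennreal (g0 a)) ^ (k + 1) \<partial>lborel)"
    and q1: "inverse (ennreal q1) ^ k < (\<integral>\<^sup>+a. inverse (ennreal (g1 a)) ^ (k + 1) \<partial>lborel)"
  shows "inverse (ennreal ((1 - u) * q0 + u * q1)) ^ k \<le> (\<integral>\<^sup>+a. inverse (ennreal (g a)) ^ (k + 1) \<partial>lborel)"
proof -
  note [measurable] = borel_measurable_convex[OF g0(1)] borel_measurable_convex[OF g1(1)] g(1)
  have "\<forall>\<^sub>F n in sequentially.
      inverse (ennreal q0) ^ k < (\<integral>\<^sup>+a. inverse (ennreal (g0 a + 1 / Suc n)) ^ (k + 1) \<partial>lborel) \<and>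
      inverse (ennreal q1) ^ k < (\<integral>\<^sup>+a. inverse (ennreal (g1 a + 1 / Suc n)) ^ (k + 1) \<partial>lborel)"
    by (intro eventually_conj eventually_less_nn_integral_shift g0 g1 q0 q1) auto
  then obtain n where "inverse (ennreal q0) ^ k < (\<integral>\<^sup>+a. inverse (ennreal (g0 a + 1 / Suc n)) ^ (k + 1) \<partial>lborel)"
      "inverse (ennreal q1) ^ k < (\<integral>\<^sup>+a. inverse (ennreal (g1 a + 1 / Suc n)) ^ (k + 1) \<partial>lborel)"
    by (auto dest: eventually_happens)
  moreover define e :: real where "e = 1 / Suc n"
  ultimately have I: "inverse (ennreal q0) ^ k \<le> (\<integral>\<^sup>+a. inverse (ennreal (g0 a + e)) ^ (k + 1) \<partial>lborel)"
      "inverse (ennreal q1) ^ k \<le> (\<integral>\<^sup>+a. inverse (ennreal (g1 a + e)) ^ (k + 1) \<partial>lborel)"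
    by auto
  have e: "0 < e" unfolding e_def by simp
  \<comment> \<open>The shift by \<open>e\<close> keeps the infimum positive even where
    \<open>h\<close> comes down to 0, so that dividing by it is possible.\<close>
  define m where "m h = (INF a. h a + e)" for h :: "real \<Rightarrow> real"
  have m: "0 < m h" "\<And>a. m h \<le> h a + e" "\<And>s. 1 < s \<Longrightarrow> \<exists>a. h a + e \<le> m h * s" if h: "\<And>a. 0 \<le> h a" for h
  proof -
    have bdd: "bdd_below (range (\<lambda>a. h a + e))"
      using h e by (intro bdd_belowI[of _ 0]) (auto intro: add_nonneg_nonneg)
    have "e \<le> m h" unfolding m_def using h by (intro cINF_greatest) auto
    then show pos: "0 < m h" using e by simp
    show "m h \<le> h a + e" for a unfolding m_def using bdd by (intro cINF_lower) auto
    show "\<exists>a. h a + e \<le> m h * s" if "1 < s" for s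
    proof -
      have "m h < m h * s" using that pos by simp
      then show ?thesis
        using bdd cINF_less_iff[of UNIV "\<lambda>a. h a + e" "m h * s"] by (auto simp: m_def intro: less_imp_le)
    qed
  qed
  \<comment> \<open>With this \<open>p\<close>, the levels \<open>s * p0\<close> and
    \<open>s * p1\<close> combine to \<open>s * p\<close>, so a common normalised level
    \<open>s\<close> carries over to \<open>g\<close>.\<close>
  define p0 p1 p where "p0 = m g0" and "p1 = m g1" and "p = (1 - u) * p0 + u * p1"
  have p: "0 < p0" "0 < p1" unfolding p0_def p1_def using m(1) g0(2) g1(2) by blast+
  have comb_pos: "0 < (1 - u) * x + u * y" if "0 < x" "0 < y" for x y :: real
    using that u by (cases "u = 0") (auto intro: add_nonneg_pos)
  have "0 < p" unfolding p_def using p by (rule comb_pos)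
  define Q where "Q = (1 - u) * q0 + u * q1"
  have Q: "0 < Q" unfolding Q_def using q by (rule comb_pos)
  have normalise: "(\<integral>\<^sup>+a. inverse (ennreal ((h a + e) / c)) ^ (k + 1) \<partial>lborel)
      = ennreal (c ^ (k + 1)) * (\<integral>\<^sup>+a. inverse (ennreal (h a + e)) ^ (k + 1) \<partial>lborel)"
    if [measurable]: "h \<in> borel_measurable borel" and "\<And>a. 0 \<le> h a" "0 < c" for h :: "real \<Rightarrow> real" and c
  proof -
    have "inverse (ennreal ((h a + e) / c)) ^ (k + 1) = ennreal (c ^ (k + 1)) * inverse (ennreal (h a + e)) ^ (k + 1)" for a
    proof -
      have "0 < h a + e" using that(2)[of a] e by simp
      then show ?thesis
        using \<open>0 < c\<close> by (simp add: inverse_ennreal ennreal_power power_divide inverse_eq_divide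
            flip: ennreal_mult del: power_Suc)
    qed
    then show ?thesis by (simp add: nn_integral_cmult)
  qed
  have conv: "convex_on UNIV (\<lambda>a. (h a + e) / c)" if "convex_on UNIV h" "0 < c" for h :: "real \<Rightarrow> real" and c
    using that by (intro convex_on_cdiv convex_on_add) (auto simp: convex_on_const)
  have "ennreal (1 - u) * (\<integral>\<^sup>+a. inverse (ennreal ((g0 a + e) / p0)) ^ (k + 1) \<partial>lborel)
       + ennreal u * (\<integral>\<^sup>+a. inverse (ennreal ((g1 a + e) / p1)) ^ (k + 1) \<partial>lborel)
       \<le> (\<integral>\<^sup>+a. inverse (ennreal ((g a + e) / p)) ^ (k + 1) \<partial>lborel)"
  proof (rule nn_integral_inverse_power_quasiconvex)
    show "convex_on UNIV (\<lambda>a. (g0 a + e) / p0)" "convex_on UNIV (\<lambda>a. (g1 a + e) / p1)"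
      using conv g0 g1 p by auto
    show "1 \<le> (g0 a + e) / p0" "1 \<le> (g1 a + e) / p1" for a
      using m(2)[of g0 a] m(2)[of g1 a] g0(2) g1(2) p by (auto simp: p0_def p1_def)
    show "\<exists>a. (g0 a + e) / p0 \<le> s" "\<exists>a. (g1 a + e) / p1 \<le> s" if "1 < s" for s
      using m(3)[of g0 s] m(3)[of g1 s] that g0(2) g1(2) p by (auto simp: p0_def p1_def field_simps)
    show "0 < (g a + e) / p" for a
      using g(2)[of a] e \<open>0 < p\<close> by (auto intro!: divide_pos_pos)
    show "(g ((1 - u) * a + u * b) + e) / p \<le> s" if "(g0 a + e) / p0 \<le> s" "(g1 b + e) / p1 \<le> s" for s a b
    proof -
      have "g0 a + e \<le> s * p0" "g1 b + e \<le> s * p1" using that p by (auto simp: field_simps)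
      then have "(1 - u) * (g0 a + e) + u * (g1 b + e) \<le> (1 - u) * (s * p0) + u * (s * p1)"
        using u by (intro add_mono mult_left_mono) auto
      also have "\<dots> = s * p" by (simp add: p_def algebra_simps)
      finally have "g ((1 - u) * a + u * b) + e \<le> s * p"
        using le[of a b] by (simp add: algebra_simps)
      then show ?thesis using \<open>0 < p\<close> by (simp add: field_simps)
    qed
  qed (use u in auto)
  also have "\<dots> = ennreal (p ^ (k + 1)) * (\<integral>\<^sup>+a. inverse (ennreal (g a + e)) ^ (k + 1) \<partial>lborel)"
    using normalise g \<open>0 < p\<close> by auto
  also have "\<dots> \<le> ennreal (p ^ (k + 1)) * (\<integral>\<^sup>+a. inverse (ennreal (g a)) ^ (k + 1) \<partial>lborel)"
    using e by (intro mult_left_mono nn_integral_mono power_mono ennreal_inverse_antimono ennreal_leI) auto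
  finally have main: "ennreal (1 - u) * (\<integral>\<^sup>+a. inverse (ennreal ((g0 a + e) / p0)) ^ (k + 1) \<partial>lborel)
       + ennreal u * (\<integral>\<^sup>+a. inverse (ennreal ((g1 a + e) / p1)) ^ (k + 1) \<partial>lborel)
       \<le> ennreal (p ^ (k + 1)) * (\<integral>\<^sup>+a. inverse (ennreal (g a)) ^ (k + 1) \<partial>lborel)" .
  have lower: "ennreal (c ^ (k + 1) / y ^ k) \<le> (\<integral>\<^sup>+a. inverse (ennreal ((h a + e) / c)) ^ (k + 1) \<partial>lborel)"
    if "h \<in> borel_measurable borel" "\<And>a. 0 \<le> h a" "0 < c" "0 < y"
      "inverse (ennreal y) ^ k \<le> (\<integral>\<^sup>+a. inverse (ennreal (h a + e)) ^ (k + 1) \<partial>lborel)" for h :: "real \<Rightarrow> real" and c y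
  proof -
    have "ennreal (c ^ (k + 1) / y ^ k) = ennreal (c ^ (k + 1)) * inverse (ennreal y) ^ k"
      using that by (simp add: ennreal_power inverse_ennreal divide_inverse power_inverse flip: ennreal_mult)
    also have "\<dots> \<le> ennreal (c ^ (k + 1)) * (\<integral>\<^sup>+a. inverse (ennreal (h a + e)) ^ (k + 1) \<partial>lborel)"
      using that by (intro mult_left_mono) auto
    finally show ?thesis using normalise[OF that(1-3)] by simp
  qed
  have "ennreal (p ^ (k + 1)) * inverse (ennreal Q) ^ k = ennreal (p ^ (k + 1) / Q ^ k)"
    using \<open>0 < p\<close> Q by (simp add: ennreal_power inverse_ennreal divide_inverse power_inverse flip: ennreal_mult)
  also have "\<dots> \<le> ennreal ((1 - u) * (p0 ^ (k + 1) / q0 ^ k) + u * (p1 ^ (k + 1) / q1 ^ k))"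
    unfolding p_def Q_def using p q u by (intro ennreal_leI power_quotient_convex) auto
  also have "\<dots> = ennreal (1 - u) * ennreal (p0 ^ (k + 1) / q0 ^ k) + ennreal u * ennreal (p1 ^ (k + 1) / q1 ^ k)"
    using p q u by (simp add: ennreal_plus ennreal_mult del: times_divide_eq_right power_Suc)
  also have "\<dots> \<le> ennreal (1 - u) * (\<integral>\<^sup>+a. inverse (ennreal ((g0 a + e) / p0)) ^ (k + 1) \<partial>lborel)
       + ennreal u * (\<integral>\<^sup>+a. inverse (ennreal ((g1 a + e) / p1)) ^ (k + 1) \<partial>lborel)"
    using I p q g0(2) g1(2) by (intro add_mono mult_left_mono lower) auto
  also note main
  finally have "ennreal (p ^ (k + 1)) * inverse (ennreal Q) ^ k
      \<le> ennreal (p ^ (k + 1)) * (\<integral>\<^sup>+a. inverse (ennreal (g a)) ^ (k + 1) \<partial>lborel)" .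
  then show ?thesis
    unfolding Q_def[symmetric] using \<open>0 < p\<close> by (subst (asm) ennreal_mult_le_mult_iff) auto
qed

section \<open>Marginals of inverse powers of convex functions\<close>

lemma inverse_ennreal_power_strict_antimono:
  assumes "0 \<le> a" "a < b" "0 < k"
  shows "inverse (ennreal b) ^ k < inverse (ennreal a) ^ k"
proof (cases "a = 0")
  case True
  then show ?thesis using assms by (simp add: inverse_ennreal ennreal_power top_power_ennreal)
next
  case False
  then show ?thesis using assms
    by (simp add: inverse_ennreal ennreal_power ennreal_less_iff power_strict_mono)
qed

text \<open>\<open>h\<close> is the integral over a fibre raised to \<open>-1 / k\<close>, and its
  convexity is Borell-Brascamp-Lieb between two fibres, since replacing a coordinate is affine in
  the vector and the new entry together. An infinite integral becomes \<open>h = 0\<close>; the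
  integral is never 0 because \<open>g\<close> is finite. \<open>h\<close> stays on the whole space,
  merely constant in coordinate \<open>i\<close>, so that the step can be iterated.\<close>

lemma convex_on_marginal:
  fixes g :: "real ^ 'n \<Rightarrow> real"
  assumes g: "convex_on UNIV g" "\<And>x. 0 \<le> g x" and k: "0 < k"
  obtains h :: "real ^ 'n \<Rightarrow> real"
  where "convex_on UNIV h" "\<And>x. 0 \<le> h x"
    and "\<And>x. (\<integral>\<^sup>+a. inverse (ennreal (g (\<chi> j. if j = i then a else x $ j))) ^ (k + 1) \<partial>lborel)
           = inverse (ennreal (h x)) ^ k"
proof -
  define up :: "real ^ 'n \<Rightarrow> real \<Rightarrow> real ^ 'n" where "up x a = (\<chi> j. if j = i then a else x $ j)" for x a
  have up: "up ((1 - u) *\<^sub>R x + u *\<^sub>R y) ((1 - u) * a + u * b) = (1 - u) *\<^sub>R up x a + u *\<^sub>R up y b" for x y a b u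
    by (vector up_def)
  define I where "I x = (\<integral>\<^sup>+a. inverse (ennreal (g (up x a))) ^ (k + 1) \<partial>lborel)" for x
  have convex_fibre: "convex_on UNIV (\<lambda>a. g (up x a))" for x
  proof (rule convex_onI)
    fix t a b :: real assume "0 < t" "t < 1"
    then show "g (up x ((1 - t) *\<^sub>R a + t *\<^sub>R b)) \<le> (1 - t) * g (up x a) + t * g (up x b)"
      using up[of t x x a b] convex_onD[OF g(1), of t "up x a" "up x b"]
      by (simp flip: scaleR_left_distrib)
  qed simp
  then have meas: "(\<lambda>a. g (up x a)) \<in> borel_measurable borel" for x
    by (intro borel_measurable_convex)
  have I_pos: "I x \<noteq> 0" for x
  proof
    assume "I x = 0"
    then have "AE a in lborel. inverse (ennreal (g (up x a))) ^ (k + 1) = 0"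
      unfolding I_def using meas by (subst (asm) nn_integral_0_iff_AE) auto
    then have "AE a::real in lborel. False"
      by (simp add: power_eq_0_iff)
    then show False by (subst (asm) AE_iff_null) (auto simp: null_sets_def)
  qed
  define h where "h x = (if I x = \<infinity> then 0 else root k (1 / enn2real (I x)))" for x
  have h_nonneg: "0 \<le> h x" for x
    unfolding h_def by (auto intro: real_root_ge_zero)
  have h: "I x = inverse (ennreal (h x)) ^ k" for x
  proof (cases "I x = \<infinity>")
    case True
    then show ?thesis using k by (simp add: h_def top_power_ennreal)
  next
    case False
    then obtain r where r: "I x = ennreal r" "0 < r"
      using I_pos[of x] by (cases "I x") (auto simp: less_le)
    then have "h x ^ k = 1 / r" "0 < h x"
      using k by (auto simp: h_def)
    then show ?thesis
      using r by (simp add: inverse_ennreal ennreal_power power_inverse)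
  qed
  have "convex_on UNIV h"
  proof (rule convex_onI)
    fix t :: real and x y :: "real ^ 'n" assume t: "0 < t" "t < 1"
    show "h ((1 - t) *\<^sub>R x + t *\<^sub>R y) \<le> (1 - t) * h x + t * h y"
    \<comment> \<open>The slack \<open>d\<close> turns the equalities for \<open>h x\<close> and
      \<open>h y\<close> into the strict bounds required for the two fibres.\<close>
    proof (rule field_le_epsilon)
      fix d :: real assume d: "0 < d"
      define z where "z = (1 - t) *\<^sub>R x + t *\<^sub>R y"
      have "inverse (ennreal ((1 - t) * (h x + d) + t * (h y + d))) ^ k
          \<le> (\<integral>\<^sup>+a. inverse (ennreal (g (up z a))) ^ (k + 1) \<partial>lborel)"
      proof (rule borell_brascamp_lieb_real[OF convex_fibre _ convex_fibre _ meas])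
        show "g (up z ((1 - t) * a + t * b)) \<le> (1 - t) * g (up x a) + t * g (up y b)" for a b
          unfolding z_def up using t by (intro convex_onD[OF g(1)]) auto
        show "inverse (ennreal (h x + d)) ^ k < (\<integral>\<^sup>+a. inverse (ennreal (g (up x a))) ^ (k + 1) \<partial>lborel)" for x
          using h[of x] d k h_nonneg[of x] unfolding I_def
          by (metis inverse_ennreal_power_strict_antimono less_add_same_cancel1)
        show "inverse (ennreal (h y + d)) ^ k < (\<integral>\<^sup>+a. inverse (ennreal (g (up y a))) ^ (k + 1) \<partial>lborel)"
          using h[of y] d k h_nonneg[of y] unfolding I_def
          by (metis inverse_ennreal_power_strict_antimono less_add_same_cancel1)
        show "0 < h x + d" "0 < h y + d"
          using h_nonneg d by (auto intro: add_nonneg_pos)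
      qed (use t g in auto)
      then have "inverse (ennreal ((1 - t) * (h x + d) + t * (h y + d))) ^ k \<le> inverse (ennreal (h z)) ^ k"
        using h[of z] unfolding I_def by simp
      moreover have "0 \<le> (1 - t) * (h x + d) + t * (h y + d)"
        using t h_nonneg d by (auto intro!: add_nonneg_nonneg mult_nonneg_nonneg)
      ultimately have "h z \<le> (1 - t) * (h x + d) + t * (h y + d)"
        using inverse_ennreal_power_strict_antimono k by (metis not_le)
      then show "h z \<le> (1 - t) * h x + t * h y + d"
        by (simp add: algebra_simps)
    qed
  qed simp
  then show thesis
    using that[of h] h_nonneg h unfolding I_def up_def by simp
qed

lemma borel_measurable_vec_lambda:
  fixes f :: "'a \<Rightarrow> 'n::finite \<Rightarrow> real"
  assumes "\<And>j. (\<lambda>y. f y j) \<in> borel_measurable M"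
  shows "(\<lambda>y. \<chi> j. f y j) \<in> borel_measurable M"
proof (subst borel_measurable_euclidean_space, rule ballI)
  fix b :: "real ^ 'n" assume "b \<in> Basis"
  then obtain j where "b = axis j 1" by (auto simp: Basis_vec_def)
  then show "(\<lambda>y. (\<chi> j. f y j) \<bullet> b) \<in> borel_measurable M"
    using assms[of j] by (simp add: inner_axis)
qed

interpretation lborel_PiM: product_sigma_finite "\<lambda>_. lborel :: real measure"
  by standard

text \<open>Each coordinate uses up one power. The induction is general in \<open>g\<close>, because
  its hypothesis is applied to the marginal of \<open>g\<close> in the newly inserted
  coordinate.\<close>

lemma convex_on_iterated_marginal:
  fixes g :: "real ^ 'n \<Rightarrow> real"
  assumes g: "convex_on UNIV g" "\<And>x. 0 \<le> g x" and k: "0 < k"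
  obtains h :: "real ^ 'n \<Rightarrow> real"
  where "convex_on UNIV h" "\<And>x. 0 \<le> h x"
    and "\<And>x. (\<integral>\<^sup>+y. inverse (ennreal (g (\<chi> j. if j \<in> J then y j else x $ j))) ^ (card J + k)
              \<partial>(\<Pi>\<^sub>M j\<in>J. lborel)) = inverse (ennreal (h x)) ^ k"
proof -
  have "\<exists>h :: real ^ 'n \<Rightarrow> real. convex_on UNIV h \<and> (\<forall>x. 0 \<le> h x) \<and>
      (\<forall>x. (\<integral>\<^sup>+y. inverse (ennreal (g (\<chi> j. if j \<in> J then y j else x $ j))) ^ (card J + k)
              \<partial>(\<Pi>\<^sub>M j\<in>J. lborel)) = inverse (ennreal (h x)) ^ k)"
    using finite[of J] g
  proof (induction J arbitrary: g rule: finite_induct)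
    case empty
    then show ?case by (intro exI[of _ g]) (auto simp: PiM_empty nn_integral_count_space_finite)
  next
    case (insert i J)
    obtain h1 where h1: "convex_on UNIV h1" "\<And>x. 0 \<le> h1 x"
      "\<And>x. (\<integral>\<^sup>+a. inverse (ennreal (g (\<chi> j. if j = i then a else x $ j))) ^ (card J + k + 1) \<partial>lborel)
           = inverse (ennreal (h1 x)) ^ (card J + k)"
      using convex_on_marginal[OF insert.prems, of "card J + k" i] k by blast
    obtain h where h: "convex_on UNIV h" "\<And>x. 0 \<le> h x"
      "\<And>x. (\<integral>\<^sup>+y. inverse (ennreal (h1 (\<chi> j. if j \<in> J then y j else x $ j))) ^ (card J + k)
              \<partial>(\<Pi>\<^sub>M j\<in>J. lborel)) = inverse (ennreal (h x)) ^ k"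
      using insert.IH[OF h1(1,2)] by blast
    have "(\<integral>\<^sup>+y. inverse (ennreal (g (\<chi> j. if j \<in> insert i J then y j else x $ j))) ^ (card (insert i J) + k)
              \<partial>(\<Pi>\<^sub>M j\<in>insert i J. lborel)) = inverse (ennreal (h x)) ^ k" for x
    proof -
      have "(\<lambda>y. \<chi> j. if j \<in> insert i J then y j else x $ j) \<in> borel_measurable (\<Pi>\<^sub>M j\<in>insert i J. lborel)"
      proof (rule borel_measurable_vec_lambda)
        fix j
        show "(\<lambda>y. if j \<in> insert i J then y j else x $ j) \<in> borel_measurable (\<Pi>\<^sub>M j\<in>insert i J. lborel)"
        proof (cases "j \<in> insert i J")
          case True
          then show ?thesis
            using measurable_component_singleton[OF True, of "\<lambda>_. lborel"] by (simp del: insert_iff)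
        qed simp
      qed
      note [measurable] = measurable_compose[OF this borel_measurable_convex[OF insert.prems(1)]]
      have "(\<integral>\<^sup>+y. inverse (ennreal (g (\<chi> j. if j \<in> insert i J then y j else x $ j))) ^ (card (insert i J) + k)
              \<partial>(\<Pi>\<^sub>M j\<in>insert i J. lborel))
          = (\<integral>\<^sup>+y. \<integral>\<^sup>+a. inverse (ennreal (g (\<chi> j. if j \<in> insert i J then (y(i := a)) j else x $ j)))
               ^ (card (insert i J) + k) \<partial>lborel \<partial>(\<Pi>\<^sub>M j\<in>J. lborel))"
        using insert.hyps by (intro lborel_PiM.product_nn_integral_insert) measurable
      also have "\<dots> = (\<integral>\<^sup>+y. \<integral>\<^sup>+a. inverse (ennreal (g (\<chi> j. if j = i then a
            else (\<chi> j. if j \<in> J then y j else x $ j) $ j))) ^ (card J + k + 1) \<partial>lborel \<partial>(\<Pi>\<^sub>M j\<in>J. lborel))"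
        using insert.hyps
        by (intro nn_integral_cong arg_cong2[where f = "(^)"] arg_cong[where f = inverse]
            arg_cong[where f = ennreal] arg_cong[where f = g]) (auto simp: vec_eq_iff)
      also have "\<dots> = inverse (ennreal (h x)) ^ k"
        by (simp only: h1(3) h(3))
      finally show ?thesis .
    qed
    then show ?case using h(1,2) by blast
  qed
  then show thesis using that by blast
qed

section \<open>Lebesgue measure in coordinates and scaling of product integrals\<close>

lemma lborel_vec: "lborel = distr (\<Pi>\<^sub>M j\<in>(UNIV :: 'n::finite set). lborel) borel (\<lambda>y. \<chi> j. (y j :: real))"
proof (rule lborel_eqI)
  have meas: "(\<lambda>y. \<chi> j. (y j :: real)) \<in> borel_measurable (\<Pi>\<^sub>M j\<in>(UNIV :: 'n set). lborel)"
    by (intro borel_measurable_vec_lambda) (auto intro: measurable_component_singleton)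
  fix l u :: "real ^ 'n" assume le: "\<And>b. b \<in> Basis \<Longrightarrow> l \<bullet> b \<le> u \<bullet> b"
  have le': "l $ j \<le> u $ j" for j
    using le[of "axis j 1"] by (simp add: inner_axis)
  have "(\<lambda>y. \<chi> j. (y j :: real)) -` box l u \<inter> space (\<Pi>\<^sub>M j\<in>(UNIV :: 'n set). lborel)
      = (\<Pi>\<^sub>E j\<in>UNIV. {l $ j <..< u $ j})"
    by (auto simp: mem_box_cart space_PiM PiE_iff)
  then have "emeasure (distr (\<Pi>\<^sub>M j\<in>(UNIV :: 'n set). lborel) borel (\<lambda>y. \<chi> j. (y j :: real))) (box l u)
      = (\<Prod>j\<in>UNIV. ennreal (u $ j - l $ j))"
    using meas le' by (simp add: emeasure_distr lborel_PiM.emeasure_PiM)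
  also have "\<dots> = ennreal (\<Prod>j\<in>UNIV. u $ j - l $ j)"
    using le' by (intro prod_ennreal) auto
  also have "(\<Prod>j\<in>UNIV. u $ j - l $ j) = (\<Prod>b\<in>Basis. (u - l) \<bullet> b)"
  proof -
    have B: "(Basis :: (real ^ 'n) set) = range (\<lambda>j. axis j 1)" by (auto simp: Basis_vec_def)
    have "inj (\<lambda>j. axis j 1 :: real ^ 'n)" by (auto simp: inj_on_def axis_eq_axis)
    then show ?thesis unfolding B by (simp add: prod.reindex inner_axis)
  qed
  finally show "emeasure (distr (\<Pi>\<^sub>M j\<in>(UNIV :: 'n set). lborel) borel (\<lambda>y. \<chi> j. (y j :: real))) (box l u)
      = ennreal (\<Prod>b\<in>Basis. (u - l) \<bullet> b)" .
qed simp

lemma measurable_PiM_scale: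
  "(\<lambda>y. \<lambda>j\<in>I. c * y j) \<in> measurable (\<Pi>\<^sub>M j\<in>I. lborel) (\<Pi>\<^sub>M j\<in>I. lborel :: real measure)"
proof (rule measurable_restrict)
  fix j assume "j \<in> I"
  from measurable_component_singleton[OF this, of "\<lambda>_. lborel :: real measure"]
  show "(\<lambda>y. c * y j) \<in> measurable (\<Pi>\<^sub>M j\<in>I. lborel) (lborel :: real measure)" by simp
qed

text \<open>The Jacobian of a homothety, one factor per coordinate. The scaled tuple is restricted
  to \<open>J\<close> because the product measure lives on extensional functions.\<close>

lemma nn_integral_PiM_scale:
  fixes f :: "('i \<Rightarrow> real) \<Rightarrow> ennreal"
  assumes J: "finite J" and f: "f \<in> borel_measurable (\<Pi>\<^sub>M j\<in>J. lborel)" and c: "c \<noteq> 0"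
  shows "(\<integral>\<^sup>+y. f y \<partial>(\<Pi>\<^sub>M j\<in>J. lborel))
       = ennreal (\<bar>c\<bar> ^ card J) * (\<integral>\<^sup>+y. f (\<lambda>j\<in>J. c * y j) \<partial>(\<Pi>\<^sub>M j\<in>J. lborel))"
  using J f
proof (induction J arbitrary: f rule: finite_induct)
  case empty
  show ?case by (simp add: PiM_empty nn_integral_count_space_finite)
next
  case (insert i J)
  note [measurable] = insert.prems
  define F where "F y = (\<integral>\<^sup>+a. f (y(i := c * a)) \<partial>lborel)" for y
  have F: "F \<in> borel_measurable (\<Pi>\<^sub>M j\<in>J. lborel)"
    unfolding F_def by measurable
  have "(\<integral>\<^sup>+y. f y \<partial>(\<Pi>\<^sub>M j\<in>insert i J. lborel)) = (\<integral>\<^sup>+y. \<integral>\<^sup>+a. f (y(i := a)) \<partial>lborel \<partial>(\<Pi>\<^sub>M j\<in>J. lborel))"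
    using insert by (intro lborel_PiM.product_nn_integral_insert) auto
  also have "\<dots> = (\<integral>\<^sup>+y. ennreal \<bar>c\<bar> * F y \<partial>(\<Pi>\<^sub>M j\<in>J. lborel))"
  proof (rule nn_integral_cong)
    fix y assume [measurable]: "y \<in> space (\<Pi>\<^sub>M j\<in>J. lborel :: real measure)"
    have "(\<lambda>a. f (y(i := a))) \<in> borel_measurable borel" by measurable
    then show "(\<integral>\<^sup>+a. f (y(i := a)) \<partial>lborel) = ennreal \<bar>c\<bar> * F y"
      using c nn_integral_real_affine[of "\<lambda>a. f (y(i := a))" c 0] by (simp add: F_def)
  qed
  also have "\<dots> = ennreal \<bar>c\<bar> * (ennreal (\<bar>c\<bar> ^ card J) * (\<integral>\<^sup>+y. F (\<lambda>j\<in>J. c * y j) \<partial>(\<Pi>\<^sub>M j\<in>J. lborel)))"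
    using F by (simp only: nn_integral_cmult insert.IH[OF F])
  also have "\<dots> = ennreal (\<bar>c\<bar> ^ card (insert i J)) * (\<integral>\<^sup>+y. F (\<lambda>j\<in>J. c * y j) \<partial>(\<Pi>\<^sub>M j\<in>J. lborel))"
    using insert.hyps by (simp add: ennreal_mult mult.assoc)
  also have "(\<integral>\<^sup>+y. F (\<lambda>j\<in>J. c * y j) \<partial>(\<Pi>\<^sub>M j\<in>J. lborel))
      = (\<integral>\<^sup>+y. \<integral>\<^sup>+a. f (\<lambda>j\<in>insert i J. c * (y(i := a)) j) \<partial>lborel \<partial>(\<Pi>\<^sub>M j\<in>J. lborel))"
    unfolding F_def using insert.hyps by (intro nn_integral_cong arg_cong[where f = f]) (auto simp: fun_eq_iff)
  also have "\<dots> = (\<integral>\<^sup>+y. f (\<lambda>j\<in>insert i J. c * y j) \<partial>(\<Pi>\<^sub>M j\<in>insert i J. lborel))"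
    using insert.hyps measurable_compose[OF measurable_PiM_scale insert.prems]
    by (intro lborel_PiM.product_nn_integral_insert[symmetric]) auto
  finally show ?case .
qed

section \<open>The projective chart and the volume of sections\<close>

lemma nn_integral_abs_power_interval:
  obtains c :: real where "0 < c"
    and "\<And>d::real. 0 \<le> d \<Longrightarrow>
      (\<integral>\<^sup>+a. ennreal (\<bar>a\<bar> ^ m) * indicator {a. \<bar>a\<bar> * d \<le> 1} a \<partial>lborel) = ennreal c * inverse (ennreal d) ^ (m + 1)"
proof -
  \<comment> \<open>The value is \<open>2 / (m + 1)\<close>; what matters is that it is positive and
    finite.\<close>
  define I where "I = (\<integral>\<^sup>+a. ennreal (\<bar>a::real\<bar> ^ m) * indicator {a. \<bar>a\<bar> \<le> 1} a \<partial>lborel)"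
  have "I \<le> (\<integral>\<^sup>+a. indicator {-1..1::real} a \<partial>lborel)"
    unfolding I_def by (intro nn_integral_mono) (auto simp: indicator_def power_le_one)
  then have "I \<noteq> \<infinity>" by (auto simp: top_unique)
  have "I \<noteq> 0"
  proof
    assume "I = 0"
    then have ae: "AE a::real in lborel. ennreal (\<bar>a\<bar> ^ m) * indicator {a. \<bar>a\<bar> \<le> 1} a = 0"
      unfolding I_def by (subst (asm) nn_integral_0_iff_AE) auto
    have "AE a::real in lborel. a \<notin> {0<..1}"
      using ae by eventually_elim (auto simp: indicator_def split: if_splits)
    then have "emeasure lborel {0<..1::real} = 0"
      by (subst (asm) AE_iff_null) (auto simp: null_sets_def greaterThanAtMost_def greaterThan_def atMost_def Int_def)
    then show False by simp
  qed
  obtain c where c: "I = ennreal c" "0 < c"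
    using \<open>I \<noteq> \<infinity>\<close> \<open>I \<noteq> 0\<close> by (cases I) (auto simp: less_le)
  have "(\<integral>\<^sup>+a. ennreal (\<bar>a\<bar> ^ m) * indicator {a. \<bar>a\<bar> * d \<le> 1} a \<partial>lborel) = ennreal c * inverse (ennreal d) ^ (m + 1)"
    if "0 \<le> d" for d :: real
  proof (cases "d = 0")
    \<comment> \<open>The interval is the whole line and the left side is infinite; so is the right
      side, because \<open>c\<close> is positive.\<close>
    case True
    have "\<infinity> = emeasure lborel {1::real..}"
    proof (cases "emeasure lborel {1::real..}")
      case (real e)
      have "emeasure lborel {1..e + 2} \<le> emeasure lborel {1::real..}"
        by (intro emeasure_mono) auto
      then show ?thesis using real by simp
    qed simp
    also have "\<dots> = (\<integral>\<^sup>+a. indicator {1::real..} a \<partial>lborel)" by simp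
    also have "\<dots> \<le> (\<integral>\<^sup>+a. ennreal (\<bar>a::real\<bar> ^ m) \<partial>lborel)"
      by (intro nn_integral_mono) (auto simp: indicator_def)
    finally show ?thesis using True c by (simp add: top_unique ennreal_mult_top top_power_ennreal)
  next
    case False
    then have d: "0 < d" using that by simp
    have "(\<integral>\<^sup>+a. ennreal (\<bar>a\<bar> ^ m) * indicator {a. \<bar>a\<bar> * d \<le> 1} a \<partial>lborel)
        = ennreal \<bar>1 / d\<bar> * (\<integral>\<^sup>+a. ennreal (\<bar>0 + 1 / d * a\<bar> ^ m) * indicator {a. \<bar>a\<bar> * d \<le> 1} (0 + 1 / d * a) \<partial>lborel)"
      using d by (intro nn_integral_real_affine) auto
    also have "(\<integral>\<^sup>+a. ennreal (\<bar>0 + 1 / d * a\<bar> ^ m) * indicator {a. \<bar>a\<bar> * d \<le> 1} (0 + 1 / d * a) \<partial>lborel)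
        = (\<integral>\<^sup>+a. ennreal ((1 / d) ^ m) * (ennreal (\<bar>a\<bar> ^ m) * indicator {a. \<bar>a\<bar> \<le> 1} a) \<partial>lborel)"
      using d by (intro nn_integral_cong)
        (auto simp: indicator_def abs_mult power_mult_distrib power_divide simp flip: ennreal_mult)
    also have "\<dots> = ennreal ((1 / d) ^ m) * ennreal c"
      unfolding c(1)[symmetric] I_def by (intro nn_integral_cmult) auto
    finally show ?thesis
      using d c(2) by (simp add: inverse_ennreal ennreal_power inverse_eq_divide mult_ac flip: ennreal_mult)
  qed
  then show thesis using that c(2) by blast
qed

lemma convex_on_linear_compose:
  assumes "convex_on UNIV f" "linear L"
  shows "convex_on UNIV (\<lambda>x. f (z + L x))"
proof (rule convex_onI)
  fix t x y assume "0 < t" "t < (1::real)"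
  then have "f ((1 - t) *\<^sub>R (z + L x) + t *\<^sub>R (z + L y)) \<le> (1 - t) * f (z + L x) + t * f (z + L y)"
    using convex_onD[OF assms(1), of t "z + L x" "z + L y"] by simp
  also have "(1 - t) *\<^sub>R (z + L x) + t *\<^sub>R (z + L y) = z + L ((1 - t) *\<^sub>R x + t *\<^sub>R y)"
    unfolding linear_add[OF assms(2)] linear_scale[OF assms(2)] by (simp add: algebra_simps)
  finally show "f (z + L ((1 - t) *\<^sub>R x + t *\<^sub>R y)) \<le> (1 - t) * f (z + L x) + t * f (z + L y)" .
qed simp

text \<open>A vector with \<open>v $ i = a\<close> nonzero is \<open>a\<close> times a vector
  \<open>y\<close> with entry 1 at \<open>i\<close>. Homogeneity turns the condition into
  \<open>\<bar>a\<bar> * D y \<le> 1\<close>, and the substitution has Jacobian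
  \<open>\<bar>a\<bar> ^ card J\<close>. Integrating out \<open>a\<close> leaves a constant times
  the power \<open>- (card J + 1)\<close> of \<open>D y\<close>, and the marginals over
  \<open>J\<close> bring the exponent down to \<open>-1\<close>.\<close>

lemma inverse_volume_sections_convex:
  fixes G :: "(real ^ 'n) \<times> real \<Rightarrow> real" and i :: 'n
  assumes G: "convex_on UNIV G" "\<And>z. 0 \<le> G z" "\<And>s z. G (s *\<^sub>R z) = \<bar>s\<bar> * G z"
  obtains h :: "real \<Rightarrow> real" where "convex_on UNIV h" "\<And>t. 0 \<le> h t"
    and "\<And>t. emeasure lborel {v. G (v, t * v $ i) \<le> 1} = inverse (ennreal (h t))"
proof -
  define J where "J = UNIV - {i}"
  have J: "insert i J = UNIV" "i \<notin> J" "finite J" by (auto simp: J_def)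
  \<comment> \<open>The chart fixes entry \<open>i\<close> of the vector to 1, so slot
    \<open>i\<close> of \<open>x\<close> is free and holds \<open>t\<close>. This places
    \<open>t\<close> and the chart coordinates in one vector.\<close>
  define g where "g x = G ((\<chi> j. if j = i then 1 else x $ j), x $ i)" for x :: "real ^ 'n"
  have "convex_on UNIV (\<lambda>x. G ((axis i 1, 0) + ((\<chi> j. if j = i then 0 else x $ j), x $ i)))"
    by (rule convex_on_linear_compose[OF G(1)]) (auto intro!: linearI simp: vec_eq_iff)
  also have "(\<lambda>x. G ((axis i 1, 0) + ((\<chi> j. if j = i then 0 else x $ j), x $ i))) = g"
    by (auto simp: g_def fun_eq_iff axis_def vec_eq_iff intro!: arg_cong[where f = G])
  finally have g: "convex_on UNIV g" .
  have "0 \<le> g x" for x using G(2) by (simp add: g_def)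
  then obtain h0 where h0: "convex_on UNIV h0" "\<And>x. 0 \<le> h0 x"
    "\<And>x. (\<integral>\<^sup>+y. inverse (ennreal (g (\<chi> j. if j \<in> J then y j else x $ j))) ^ (card J + 1)
              \<partial>(\<Pi>\<^sub>M j\<in>J. lborel)) = inverse (ennreal (h0 x)) ^ 1"
    using convex_on_iterated_marginal[OF g, of 1 J] by auto
  obtain c where c: "0 < c" "\<And>d::real. 0 \<le> d \<Longrightarrow>
      (\<integral>\<^sup>+a. ennreal (\<bar>a\<bar> ^ card J) * indicator {a. \<bar>a\<bar> * d \<le> 1} a \<partial>lborel) = ennreal c * inverse (ennreal d) ^ (card J + 1)"
    using nn_integral_abs_power_interval[of "card J"] by blast
  \<comment> \<open>Only coordinate \<open>i\<close> lies outside \<open>J\<close> and influences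
    \<open>h0\<close>; the constant vector is a convenient linear embedding of \<open>t\<close>. The
    factor \<open>c\<close> is the integral over the scale \<open>a\<close>.\<close>
  define h where "h t = h0 (\<chi> j. t) / c" for t
  have "convex_on UNIV (\<lambda>t. h0 (0 + (\<chi> j. t)))"
    by (rule convex_on_linear_compose[OF h0(1)]) (auto intro!: linearI simp: vec_eq_iff)
  then have "convex_on UNIV h"
    unfolding h_def using c by (intro convex_on_cdiv) auto
  moreover have "0 \<le> h t" for t using h0(2) c by (simp add: h_def)
  moreover have "emeasure lborel {v. G (v, t * v $ i) \<le> 1} = inverse (ennreal (h t))" for t
  proof -
    have contG: "continuous_on UNIV G"
      using G(1) by (intro convex_on_continuous) auto
    define S where "S = {v. G (v, t * v $ i) \<le> 1}"
    have "closed S"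
      unfolding S_def
      by (intro closed_Collect_le continuous_intros continuous_on_compose2[OF contG]) auto
    then have S[measurable]: "S \<in> sets borel" by simp
    have vec[measurable]: "(\<lambda>y. \<chi> j. (y j :: real)) \<in> borel_measurable (\<Pi>\<^sub>M j\<in>(UNIV :: 'n set). lborel)"
      by (intro borel_measurable_vec_lambda) (auto intro: measurable_component_singleton)
    define D where "D z = G ((\<chi> j. if j = i then 1 else z j), t)" for z :: "'n \<Rightarrow> real"
    have D[measurable]: "D \<in> borel_measurable (\<Pi>\<^sub>M j\<in>UNIV. lborel)"
    proof -
      have "(\<lambda>z. \<chi> j. if j = i then 1 else (z j :: real)) \<in> borel_measurable (\<Pi>\<^sub>M j\<in>(UNIV :: 'n set). lborel)"
      proof (rule borel_measurable_vec_lambda)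
        show "(\<lambda>z. if j = i then 1 else (z j :: real)) \<in> borel_measurable (\<Pi>\<^sub>M j\<in>(UNIV :: 'n set). lborel)" for j
          by (cases "j = i") (auto intro: measurable_component_singleton)
      qed
      moreover have "(\<lambda>v. G (v, t)) \<in> borel_measurable borel"
        by (intro borel_measurable_continuous_onI continuous_intros continuous_on_compose2[OF contG]) auto
      ultimately show ?thesis unfolding D_def by (rule measurable_compose)
    qed
    define f where "f z = (indicator S (\<chi> j. z j) :: ennreal)" for z
    have f[measurable]: "f \<in> borel_measurable (\<Pi>\<^sub>M j\<in>UNIV. lborel)"
      unfolding f_def by measurable
    \<comment> \<open>What \<open>f\<close> becomes after the coordinates in \<open>J\<close> are
      rescaled by the entry at \<open>i\<close>: the Jacobian times the condition on that entry
      alone.\<close>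
    define \<Phi> where "\<Phi> z = ennreal (\<bar>z i\<bar> ^ card J) * indicator {a. \<bar>a\<bar> * D z \<le> 1} (z i)" for z :: "'n \<Rightarrow> real"
    have [measurable]: "(\<lambda>z. z i) \<in> borel_measurable (\<Pi>\<^sub>M j\<in>(UNIV :: 'n set). lborel :: real measure)"
      using measurable_component_singleton[of i UNIV "\<lambda>_. lborel :: real measure"] by simp
    have \<Phi>[measurable]: "\<Phi> \<in> borel_measurable (\<Pi>\<^sub>M j\<in>UNIV. lborel)"
      unfolding \<Phi>_def indicator_def by measurable
    have D_upd: "D (z(i := a)) = D z" for z a
      by (auto simp: D_def intro!: arg_cong[where f = G] simp: vec_eq_iff)
    have slice: "(\<integral>\<^sup>+y. f (y(i := a)) \<partial>(\<Pi>\<^sub>M j\<in>J. lborel)) = (\<integral>\<^sup>+y. \<Phi> (y(i := a)) \<partial>(\<Pi>\<^sub>M j\<in>J. lborel))"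
      if a: "a \<noteq> 0" for a
    proof -
      have upd: "(\<lambda>y. y(i := a)) \<in> measurable (\<Pi>\<^sub>M j\<in>J. lborel) (\<Pi>\<^sub>M j\<in>UNIV. lborel :: real measure)"
        using J by (intro measurable_fun_upd[where J = J]) auto
      have "(\<integral>\<^sup>+y. f (y(i := a)) \<partial>(\<Pi>\<^sub>M j\<in>J. lborel))
          = ennreal (\<bar>a\<bar> ^ card J) * (\<integral>\<^sup>+y. f ((\<lambda>j\<in>J. a * y j)(i := a)) \<partial>(\<Pi>\<^sub>M j\<in>J. lborel))"
        using measurable_compose[OF upd f] a J by (intro nn_integral_PiM_scale) auto
      also have "\<dots> = (\<integral>\<^sup>+y. ennreal (\<bar>a\<bar> ^ card J) * f ((\<lambda>j\<in>J. a * y j)(i := a)) \<partial>(\<Pi>\<^sub>M j\<in>J. lborel))"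
      proof (rule nn_integral_cmult[symmetric])
        from measurable_compose[OF measurable_compose[OF measurable_PiM_scale upd] f]
        show "(\<lambda>y. f ((\<lambda>j\<in>J. a * y j)(i := a))) \<in> borel_measurable (\<Pi>\<^sub>M j\<in>J. lborel)" .
      qed
      also have "\<dots> = (\<integral>\<^sup>+y. \<Phi> (y(i := a)) \<partial>(\<Pi>\<^sub>M j\<in>J. lborel))"
      proof (rule nn_integral_cong)
        fix y :: "'n \<Rightarrow> real"
        define v :: "real ^ 'n" where "v = (\<chi> j. ((\<lambda>j\<in>J. a * y j)(i := a)) j)"
        have "(v, t * v $ i) = a *\<^sub>R ((\<chi> j. if j = i then 1 else y j), t)"
          by (auto simp: v_def vec_eq_iff J_def)
        then have "G (v, t * v $ i) = \<bar>a\<bar> * D y"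
          unfolding D_def G(3)[symmetric] by (rule arg_cong)
        then show "ennreal (\<bar>a\<bar> ^ card J) * f ((\<lambda>j\<in>J. a * y j)(i := a)) = \<Phi> (y(i := a))"
          unfolding f_def \<Phi>_def D_upd v_def[symmetric] by (simp add: S_def indicator_def)
      qed
      finally show ?thesis .
    qed
    have "emeasure lborel S = (\<integral>\<^sup>+v. indicator S v \<partial>lborel)" by simp
    also have "\<dots> = (\<integral>\<^sup>+z. f z \<partial>(\<Pi>\<^sub>M j\<in>UNIV. lborel))"
      unfolding f_def by (subst lborel_vec) (intro nn_integral_distr vec, simp)
    also have "\<dots> = (\<integral>\<^sup>+a. \<integral>\<^sup>+y. f (y(i := a)) \<partial>(\<Pi>\<^sub>M j\<in>J. lborel) \<partial>lborel)"
      using lborel_PiM.product_nn_integral_insert_rev[OF J(3,2), of f] f by (simp add: J(1))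
    \<comment> \<open>The slice \<open>a = 0\<close> is not covered by the chart, but it is a single
      value of \<open>a\<close>.\<close>
    also have "\<dots> = (\<integral>\<^sup>+a. \<integral>\<^sup>+y. \<Phi> (y(i := a)) \<partial>(\<Pi>\<^sub>M j\<in>J. lborel) \<partial>lborel)"
      using AE_lborel_singleton[of "0::real"] by (intro nn_integral_cong_AE) (auto elim!: eventually_mono slice)
    also have "\<dots> = (\<integral>\<^sup>+z. \<Phi> z \<partial>(\<Pi>\<^sub>M j\<in>UNIV. lborel))"
      using lborel_PiM.product_nn_integral_insert_rev[OF J(3,2), of \<Phi>] \<Phi> by (simp add: J(1))
    also have "\<dots> = (\<integral>\<^sup>+y. \<integral>\<^sup>+a. \<Phi> (y(i := a)) \<partial>lborel \<partial>(\<Pi>\<^sub>M j\<in>J. lborel))"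
      using lborel_PiM.product_nn_integral_insert[OF J(3,2), of \<Phi>] \<Phi> by (simp add: J(1))
    also have "\<dots> = (\<integral>\<^sup>+y. ennreal c * inverse (ennreal (D y)) ^ (card J + 1) \<partial>(\<Pi>\<^sub>M j\<in>J. lborel))"
    proof (rule nn_integral_cong)
      fix y
      have "0 \<le> D y" using G(2) by (simp add: D_def)
      then show "(\<integral>\<^sup>+a. \<Phi> (y(i := a)) \<partial>lborel) = ennreal c * inverse (ennreal (D y)) ^ (card J + 1)"
        unfolding \<Phi>_def D_upd using c(2)[of "D y"] by simp
    qed
    also have "\<dots> = (\<integral>\<^sup>+y. ennreal c * inverse (ennreal (g (\<chi> j. if j \<in> J then y j else (\<chi> j. t) $ j))) ^ (card J + 1)
              \<partial>(\<Pi>\<^sub>M j\<in>J. lborel))"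
    proof -
      have "D y = g (\<chi> j. if j \<in> J then y j else (\<chi> j. t) $ j)" for y
        by (auto simp: D_def g_def J_def vec_eq_iff intro!: arg_cong[where f = G])
      then show ?thesis by simp
    qed
    also have "\<dots> = ennreal c * inverse (ennreal (h0 (\<chi> j. t)))"
    proof (subst nn_integral_cmult)
      have "(\<lambda>y. \<chi> j. if j \<in> J then y j else (\<chi> j. t) $ j) \<in> borel_measurable (\<Pi>\<^sub>M j\<in>J. lborel)"
      proof (rule borel_measurable_vec_lambda)
        show "(\<lambda>y. if j \<in> J then y j else (\<chi> j. t) $ j) \<in> borel_measurable (\<Pi>\<^sub>M j\<in>J. lborel)" for j
          using measurable_component_singleton[of j J "\<lambda>_. lborel :: real measure"] by (cases "j \<in> J") auto
      qed
      from measurable_compose[OF this borel_measurable_convex[OF g]]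
      show "(\<lambda>y. inverse (ennreal (g (\<chi> j. if j \<in> J then y j else (\<chi> j. t) $ j))) ^ (card J + 1))
          \<in> borel_measurable (\<Pi>\<^sub>M j\<in>J. lborel)" by measurable
    qed (simp only: h0(3) power_one_right)
    also have "\<dots> = inverse (ennreal (h t))"
    proof (cases "h0 (\<chi> j. t) = 0")
      case True
      then show ?thesis using c by (simp add: h_def ennreal_mult_top)
    next
      case False
      then have "0 < h0 (\<chi> j. t)" using h0(2)[of "\<chi> j. t"] by simp
      then show ?thesis using c
        by (simp add: h_def inverse_ennreal field_simps flip: ennreal_mult)
    qed
    finally show ?thesis unfolding S_def .
  qed
  ultimately show thesis using that by blast
qed

section \<open>Shears along a direction\<close>

lemma nn_integral_lborel_translate:
  fixes f :: "'a::euclidean_space \<Rightarrow> ennreal"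
  assumes [measurable]: "f \<in> borel_measurable borel"
  shows "(\<integral>\<^sup>+x. f (x + c) \<partial>lborel) = (\<integral>\<^sup>+x. f x \<partial>lborel)"
proof -
  have "(\<integral>\<^sup>+x. f x \<partial>lborel) = (\<integral>\<^sup>+x. f x \<partial>distr lborel borel ((+) c))"
    by (simp add: lborel_distr_plus)
  also have "\<dots> = (\<integral>\<^sup>+x. f (c + x) \<partial>lborel)"
    by (subst nn_integral_distr) auto
  finally show ?thesis by (simp add: add.commute)
qed

text \<open>Averaging over the translates of \<open>x\<close> by \<open>s *\<^sub>R \<theta>\<close> with \<open>s\<close> in the unit interval turns the
  displacement into a translation of \<open>s\<close>, so that no coordinates adapted to \<open>\<theta>\<close> are needed.\<close>

lemma nn_integral_shear:
  fixes b :: "'a::euclidean_space \<Rightarrow> real" and \<theta> :: 'a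
  assumes [measurable]: "b \<in> borel_measurable borel" and b: "\<And>x s. b (x + s *\<^sub>R \<theta>) = b x"
    and [measurable]: "f \<in> borel_measurable borel"
  shows "(\<integral>\<^sup>+x. f (x + b x *\<^sub>R \<theta>) \<partial>lborel) = (\<integral>\<^sup>+x. f x \<partial>lborel)"
proof -
  define I where "I = {0..1::real}"
  have [measurable]: "I \<in> sets borel" by (simp add: I_def)
  have mass: "(\<integral>\<^sup>+s. indicator I (s - d) \<partial>lborel) = 1" for d
    using nn_integral_lborel_translate[of "\<lambda>s. indicator I s" "- d"] by (simp add: I_def)
  have b': "b (x - s *\<^sub>R \<theta>) = b x" for x s
    using b[of x "- s"] by simp
  have "(\<integral>\<^sup>+x. f (x + b x *\<^sub>R \<theta>) \<partial>lborel)
      = (\<integral>\<^sup>+s. indicator I (s - 0) * (\<integral>\<^sup>+x. f (x + b x *\<^sub>R \<theta>) \<partial>lborel) \<partial>lborel)"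
    by (subst nn_integral_multc) (simp_all only: mass, measurable)
  also have "\<dots> = (\<integral>\<^sup>+s. \<integral>\<^sup>+x. indicator I s * f (x + (s + b x) *\<^sub>R \<theta>) \<partial>lborel \<partial>lborel)"
  proof (rule nn_integral_cong)
    fix s :: real
    have "(\<integral>\<^sup>+x. f (x + b x *\<^sub>R \<theta>) \<partial>lborel) = (\<integral>\<^sup>+x. f (x + (s + b x) *\<^sub>R \<theta>) \<partial>lborel)"
      using nn_integral_lborel_translate[of "\<lambda>x. f (x + b x *\<^sub>R \<theta>)" "s *\<^sub>R \<theta>"]
      by (simp add: b algebra_simps)
    then show "indicator I (s - 0) * (\<integral>\<^sup>+x. f (x + b x *\<^sub>R \<theta>) \<partial>lborel)
        = (\<integral>\<^sup>+x. indicator I s * f (x + (s + b x) *\<^sub>R \<theta>) \<partial>lborel)"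
      by (simp add: nn_integral_cmult)
  qed
  also have "\<dots> = (\<integral>\<^sup>+x. \<integral>\<^sup>+s. indicator I s * f (x + (s + b x) *\<^sub>R \<theta>) \<partial>lborel \<partial>lborel)"
    by (intro lborel_pair.Fubini'[symmetric]) (simp add: split_beta')
  also have "\<dots> = (\<integral>\<^sup>+x. \<integral>\<^sup>+s. indicator I (s - b x) * f (x + s *\<^sub>R \<theta>) \<partial>lborel \<partial>lborel)"
  proof (rule nn_integral_cong)
    fix x
    show "(\<integral>\<^sup>+s. indicator I s * f (x + (s + b x) *\<^sub>R \<theta>) \<partial>lborel)
        = (\<integral>\<^sup>+s. indicator I (s - b x) * f (x + s *\<^sub>R \<theta>) \<partial>lborel)"
      using nn_integral_lborel_translate[of "\<lambda>s. indicator I (s - b x) * f (x + s *\<^sub>R \<theta>)" "b x"] by simp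
  qed
  also have "\<dots> = (\<integral>\<^sup>+s. \<integral>\<^sup>+x. indicator I (s - b x) * f (x + s *\<^sub>R \<theta>) \<partial>lborel \<partial>lborel)"
    by (intro lborel_pair.Fubini') (simp add: split_beta')
  also have "\<dots> = (\<integral>\<^sup>+s. \<integral>\<^sup>+x. indicator I (s - b x) * f x \<partial>lborel \<partial>lborel)"
  proof (rule nn_integral_cong)
    fix s :: real
    show "(\<integral>\<^sup>+x. indicator I (s - b x) * f (x + s *\<^sub>R \<theta>) \<partial>lborel) = (\<integral>\<^sup>+x. indicator I (s - b x) * f x \<partial>lborel)"
      using nn_integral_lborel_translate[of "\<lambda>x. indicator I (s - b x) * f x" "s *\<^sub>R \<theta>"] by (simp add: b)
  qed
  also have "\<dots> = (\<integral>\<^sup>+x. \<integral>\<^sup>+s. indicator I (s - b x) * f x \<partial>lborel \<partial>lborel)"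
    by (intro lborel_pair.Fubini'[symmetric]) (simp add: split_beta')
  also have "\<dots> = (\<integral>\<^sup>+x. f x \<partial>lborel)"
    by (intro nn_integral_cong) (simp add: nn_integral_multc mass)
  finally show ?thesis .
qed

lemma distr_lborel_shear:
  fixes b :: "'a::euclidean_space \<Rightarrow> real" and \<theta> :: 'a
  assumes [measurable]: "b \<in> borel_measurable borel" and b: "\<And>x s. b (x + s *\<^sub>R \<theta>) = b x"
  shows "distr lborel borel (\<lambda>x. x + b x *\<^sub>R \<theta>) = lborel"
proof (rule measure_eqI)
  fix A assume "A \<in> sets (distr lborel borel (\<lambda>x. x + b x *\<^sub>R \<theta>))"
  then have [measurable]: "A \<in> sets borel" by simp
  have "emeasure (distr lborel borel (\<lambda>x. x + b x *\<^sub>R \<theta>)) A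
      = (\<integral>\<^sup>+x. indicator A x \<partial>distr lborel borel (\<lambda>x. x + b x *\<^sub>R \<theta>))" by simp
  also have "\<dots> = (\<integral>\<^sup>+x. indicator A (x + b x *\<^sub>R \<theta>) \<partial>lborel)"
    by (subst nn_integral_distr) auto
  also have "\<dots> = emeasure lborel A"
    by (subst nn_integral_shear[OF _ b]) auto
  finally show "emeasure (distr lborel borel (\<lambda>x. x + b x *\<^sub>R \<theta>)) A = emeasure lborel A" .
qed simp

text \<open>The substituted vector has inner product \<open>v $ i\<close> with
  \<open>\<theta>\<close>, so the direction of movement becomes a coordinate. The map is a shear
  along axis \<open>i\<close> followed by scaling entry \<open>i\<close> by
  \<open>1 / \<theta> $ i\<close>, which explains the constant.\<close>

lemma emeasure_lborel_coordinate_change: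
  fixes \<theta> :: "real ^ 'n" and S :: "(real ^ 'n) set"
  assumes i: "\<theta> $ i \<noteq> 0" and [measurable]: "S \<in> sets borel"
  shows "emeasure lborel S = ennreal (1 / \<bar>\<theta> $ i\<bar>)
      * emeasure lborel {v. v + ((v $ i - v \<bullet> \<theta>) / \<theta> $ i) *\<^sub>R axis i 1 \<in> S}"
proof -
  define c :: "real ^ 'n \<Rightarrow> real" where "c j = (if j = axis i 1 then 1 / \<theta> $ i else 1)" for j
  define T :: "real ^ 'n \<Rightarrow> real ^ 'n" where "T x = 0 + (\<Sum>j\<in>Basis. (c j * (x \<bullet> j)) *\<^sub>R j)" for x
  have T: "T x = x + ((1 / \<theta> $ i - 1) * x $ i) *\<^sub>R axis i 1" for x
  proof -
    have "T x = (\<Sum>j\<in>Basis. (x \<bullet> j) *\<^sub>R j) + (\<Sum>j\<in>Basis. ((c j - 1) * (x \<bullet> j)) *\<^sub>R j)"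
      by (simp add: T_def algebra_simps flip: sum.distrib)
    also have "(\<Sum>j\<in>Basis. ((c j - 1) * (x \<bullet> j)) *\<^sub>R j) = (\<Sum>j\<in>{axis i 1}. ((c j - 1) * (x \<bullet> j)) *\<^sub>R j)"
      by (intro sum.mono_neutral_right) (auto simp: c_def axis_in_Basis_iff)
    finally show ?thesis by (simp add: c_def euclidean_representation inner_axis)
  qed
  have [measurable]: "T \<in> borel_measurable borel" by (simp add: T_def[abs_def])
  have "(\<Prod>j\<in>Basis. \<bar>c j\<bar>) = (\<Prod>j\<in>{axis i 1}. \<bar>c j\<bar>)"
    by (intro prod.mono_neutral_right) (auto simp: c_def axis_in_Basis_iff)
  then have "lborel = density (distr lborel borel T) (\<lambda>_. ennreal (1 / \<bar>\<theta> $ i\<bar>))"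
    using lborel_affine_euclidean[of c 0] i by (simp add: c_def T_def[abs_def] split: if_splits)
  then have "emeasure lborel S = emeasure (density (distr lborel borel T) (\<lambda>_. ennreal (1 / \<bar>\<theta> $ i\<bar>))) S"
    by simp
  also have "\<dots> = ennreal (1 / \<bar>\<theta> $ i\<bar>) * emeasure (distr lborel borel T) S"
    by (simp add: emeasure_density_const)
  also have "emeasure (distr lborel borel T) S = emeasure lborel (T -` S)"
    by (simp add: emeasure_distr)
  also have "\<dots> = emeasure (distr lborel borel (\<lambda>x. x + (x $ i * \<theta> $ i - x \<bullet> \<theta>) *\<^sub>R axis i 1)) (T -` S)"
    by (subst distr_lborel_shear) (auto simp: inner_add_left inner_axis algebra_simps inner_commute[of _ \<theta>])
  also have "\<dots> = emeasure lborel ((\<lambda>x. x + (x $ i * \<theta> $ i - x \<bullet> \<theta>) *\<^sub>R axis i 1) -` T -` S)"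
    using measurable_sets_borel[of T borel S] by (subst emeasure_distr) auto
  also have "(\<lambda>x. x + (x $ i * \<theta> $ i - x \<bullet> \<theta>) *\<^sub>R axis i 1) -` T -` S
      = {v. v + ((v $ i - v \<bullet> \<theta>) / \<theta> $ i) *\<^sub>R axis i 1 \<in> S}"
  proof -
    have "T (v + (v $ i * \<theta> $ i - v \<bullet> \<theta>) *\<^sub>R axis i 1) = v + ((v $ i - v \<bullet> \<theta>) / \<theta> $ i) *\<^sub>R axis i 1" for v
      unfolding T using i by (simp add: field_simps flip: scaleR_left_distrib)
    then show ?thesis by auto
  qed
  finally show ?thesis .
qed

section \<open>Volume of the polar along a shadow system\<close>

definition support_fn :: "'a::euclidean_space set \<Rightarrow> 'a \<Rightarrow> real" where
  "support_fn C v = (SUP c\<in>C. v \<bullet> c)"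

lemma support_fn_le_iff:
  assumes "compact C" "C \<noteq> {}"
  shows "support_fn C v \<le> s \<longleftrightarrow> (\<forall>c\<in>C. v \<bullet> c \<le> s)"
proof -
  have "compact ((\<bullet>) v ` C)"
    using assms by (intro compact_continuous_image continuous_intros)
  then have "bdd_above ((\<bullet>) v ` C)"
    by (intro bounded_imp_bdd_above compact_imp_bounded)
  then show ?thesis
    unfolding support_fn_def using assms by (intro cSUP_le_iff) auto
qed

lemma inner_le_support_fn:
  assumes "compact C" "c \<in> C"
  shows "v \<bullet> c \<le> support_fn C v"
  using assms support_fn_le_iff[of C v "support_fn C v"] by auto

lemma convex_on_support_fn:
  assumes "compact C" "C \<noteq> {}"
  shows "convex_on UNIV (support_fn C)"
proof (rule convex_onI)
  fix t :: real and x y :: 'a assume "0 < t" "t < 1"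
  then show "support_fn C ((1 - t) *\<^sub>R x + t *\<^sub>R y) \<le> (1 - t) * support_fn C x + t * support_fn C y"
    using assms by (subst support_fn_le_iff)
      (auto simp: inner_add_left intro!: add_mono mult_left_mono inner_le_support_fn)
qed simp

lemma support_fn_nonneg:
  assumes "compact C" "0 \<in> C"
  shows "0 \<le> support_fn C v"
  using inner_le_support_fn[OF assms, of v] by simp

lemma support_fn_scale:
  assumes C: "compact C" "C \<noteq> {}" "centrally_symmetric C"
  shows "support_fn C (s *\<^sub>R v) = \<bar>s\<bar> * support_fn C v"
proof -
  have sym: "- c \<in> C" if "c \<in> C" for c
    using that C(3) unfolding centrally_symmetric_def by blast
  have minus: "support_fn C (- v) \<le> support_fn C v" for v
  proof -
    have "- v \<bullet> c \<le> support_fn C v" if "c \<in> C" for c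
      using inner_le_support_fn[OF C(1) sym[OF that], of v] by simp
    then show ?thesis using C by (subst support_fn_le_iff) auto
  qed
  have pos: "support_fn C (s *\<^sub>R v) = s * support_fn C v" if "0 < s" for s v
  proof -
    have "support_fn C (s *\<^sub>R v) \<le> z \<longleftrightarrow> s * support_fn C v \<le> z" for z
    proof -
      have "s * support_fn C v \<le> z \<longleftrightarrow> support_fn C v \<le> z / s"
        using that by (simp add: field_simps)
      also have "\<dots> \<longleftrightarrow> (\<forall>c\<in>C. v \<bullet> c \<le> z / s)"
        using C by (intro support_fn_le_iff)
      also have "\<dots> \<longleftrightarrow> support_fn C (s *\<^sub>R v) \<le> z"
        using C that by (simp add: support_fn_le_iff pos_le_divide_eq mult.commute)
      finally show ?thesis by simp
    qed
    then show ?thesis by (meson order_antisym order_refl)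
  qed
  have zero: "support_fn C 0 = 0"
    using C(2) by (simp add: support_fn_def)
  consider "s = 0" | "0 < s" | "s < 0" by linarith
  then show ?thesis
  proof cases
    case 3
    then have "support_fn C (s *\<^sub>R v) = - s * support_fn C (- v)"
      using pos[of "- s" "- v"] by simp
    also have "support_fn C (- v) = support_fn C v"
      using minus[of v] minus[of "- v"] by simp
    finally show ?thesis using 3 by simp
  qed (use pos zero in auto)
qed

text \<open>Passing to the adjoint of the linear map with columns \<open>x i\<close> moves the
  condition from the image of \<open>C\<close> back to \<open>C\<close>.\<close>

lemma polar_comb_image:
  fixes C :: "(real ^ 'm) set" and x :: "'m \<Rightarrow> 'a::euclidean_space"
  assumes "compact C" "C \<noteq> {}"
  shows "polar (comb_image x C) = {w. support_fn C (\<chi> i. w \<bullet> x i) \<le> 1}"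
proof -
  have "w \<bullet> (\<Sum>i\<in>UNIV. (c $ i) *\<^sub>R x i) = (\<chi> i. w \<bullet> x i) \<bullet> c" for w and c :: "real ^ 'm"
    by (simp add: inner_sum_right inner_vec_def mult.commute)
  then show ?thesis
    using assms by (auto simp: polar_def comb_image_def support_fn_le_iff)
qed

text \<open>For \<open>h = 0\<close> the volume is infinite, and the value 0 prescribed in
  \<open>vol_neg_powr\<close> agrees with \<open>0 powr r = 0\<close>.\<close>

lemma vol_neg_powr_eq_powr:
  assumes "S \<in> sets borel" and S: "emeasure lborel S = inverse (ennreal h)" and h: "0 \<le> h"
  shows "vol_neg_powr r S = h powr r"
proof (cases "h = 0")
  case True
  then show ?thesis using assms by (simp add: vol_neg_powr_def)
next
  case False
  then have "0 < h" using h by simp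
  then have "emeasure lebesgue S = ennreal (1 / h)"
    using assms by (simp add: inverse_ennreal inverse_eq_divide)
  then have "emeasure lebesgue S \<noteq> \<infinity>" "measure lebesgue S = 1 / h"
    using \<open>0 < h\<close> by (auto simp: measure_def)
  then show ?thesis
    using \<open>0 < h\<close> by (simp add: vol_neg_powr_def powr_minus powr_divide)
qed

lemma convex_on_powr_nonneg:
  assumes f: "convex_on UNIV f" "\<And>x. 0 \<le> f x" and r: "1 \<le> r"
  shows "convex_on UNIV (\<lambda>x. f x powr r)"
proof (rule convex_onI)
  fix t x y assume t: "0 < t" "t < (1::real)"
  \<comment> \<open>If one endpoint value is 0, the claim reduces to
    \<open>t powr r \<le> t\<close>, which holds for \<open>r\<close> at least 1 and
    \<open>t\<close> in the unit interval. The other case uses convexity of the power at positive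
    values.\<close>
  have zero: "(t * z) powr r \<le> t * z powr r" if "0 \<le> z" "0 < t" "t < 1" for t z :: real
    using that r powr_mono'[of 1 r t] by (auto simp: powr_mult intro!: mult_right_mono)
  have "f ((1 - t) *\<^sub>R x + t *\<^sub>R y) powr r \<le> ((1 - t) * f x + t * f y) powr r"
    using f t r convex_onD[OF f(1), of t x y] by (intro powr_mono2) auto
  also have "\<dots> \<le> (1 - t) * f x powr r + t * f y powr r"
  proof (cases "f x = 0 \<or> f y = 0")
    case True
    then show ?thesis using zero[of "f x" "1 - t"] zero[of "f y" t] t f(2)[of x] f(2)[of y] by auto
  next
    case False
    then have "0 < f x" "0 < f y" using f(2)[of x] f(2)[of y] by auto
    then show ?thesis using convex_onD[OF powr_convex[OF r], of t "f x" "f y"] t by simp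
  qed
  finally show "f ((1 - t) *\<^sub>R x + t *\<^sub>R y) powr r \<le> (1 - t) * f x powr r + t * f y powr r" .
qed simp

lemma closed_polar_sublevel:
  fixes C :: "(real ^ 'm) set" and x :: "'m \<Rightarrow> 'a::euclidean_space"
  assumes "compact C" "C \<noteq> {}"
  shows "closed {w. support_fn C (\<chi> i. w \<bullet> x i) \<le> 1}"
  using assms
  by (intro closed_Collect_le continuous_intros
      continuous_on_compose2[OF convex_on_continuous[OF open_UNIV convex_on_support_fn]]) auto

text \<open>With \<open>w = L v\<close> and \<open>w \<bullet> \<theta> = v $ i\<close>, the inner
  product of \<open>w\<close> with the \<open>l\<close>-th moving point is
  \<open>L v \<bullet> y l + (t * v $ i) * b l\<close>, which is linear in the pair
  \<open>(v, t * v $ i)\<close>. Composing with the support function gives the fixed function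
  \<open>G\<close>; its absolute homogeneity comes from the symmetry of \<open>C\<close>.\<close>

lemma vol_neg_powr_polar_shadow_convex:
  fixes C :: "(real ^ 'm) set" and y :: "'m \<Rightarrow> real ^ 'n" and \<theta> :: "real ^ 'n"
  assumes C: "compact C" "0 \<in> C" "centrally_symmetric C" and \<theta>: "\<theta> \<noteq> 0" and r: "1 \<le> r"
  shows "convex_on UNIV (\<lambda>t. vol_neg_powr r (polar (comb_image (\<lambda>l. y l + (t * b l) *\<^sub>R \<theta>) C)))"
proof -
  have ne: "C \<noteq> {}" using C by auto
  obtain i where i: "\<theta> $ i \<noteq> 0" using \<theta> by (auto simp: vec_eq_iff)
  define L where "L v = v + ((v $ i - v \<bullet> \<theta>) / \<theta> $ i) *\<^sub>R axis i 1" for v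
  have L: "linear L"
    unfolding L_def by (rule linearI) (auto simp: vec_eq_iff inner_add_left axis_def algebra_simps add_divide_distrib diff_divide_distrib)
  have L_inner: "L v \<bullet> \<theta> = v $ i" for v
    using i by (simp add: L_def inner_add_left inner_axis' field_simps)
  define M where "M z = (\<chi> l. L (fst z) \<bullet> y l + snd z * b l)" for z :: "(real ^ 'n) \<times> real"
  have M: "linear M"
    unfolding M_def by (rule linearI)
      (auto simp: vec_eq_iff linear_add[OF L] linear_scale[OF L] inner_add_left algebra_simps)
  define G where "G z = support_fn C (M z)" for z
  have "convex_on UNIV (\<lambda>z. support_fn C (0 + M z))"
    by (intro convex_on_linear_compose convex_on_support_fn C ne M)
  then have G1: "convex_on UNIV G" by (simp add: G_def[abs_def])
  have G2: "0 \<le> G z" for z unfolding G_def by (intro support_fn_nonneg C)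
  have G3: "G (s *\<^sub>R z) = \<bar>s\<bar> * G z" for s z
    unfolding G_def linear_scale[OF M] by (intro support_fn_scale C ne)
  obtain h where h: "convex_on UNIV h" "\<And>t. 0 \<le> h t"
    "\<And>t. emeasure lborel {v. G (v, t * v $ i) \<le> 1} = inverse (ennreal (h t))"
    using inverse_volume_sections_convex[OF G1 G2 G3, of i] by blast
  have "vol_neg_powr r (polar (comb_image (\<lambda>l. y l + (t * b l) *\<^sub>R \<theta>) C)) = (\<bar>\<theta> $ i\<bar> * h t) powr r" for t
  proof (rule vol_neg_powr_eq_powr)
    define P where "P = polar (comb_image (\<lambda>l. y l + (t * b l) *\<^sub>R \<theta>) C)"
    have P: "P = {w. support_fn C (\<chi> l. w \<bullet> (y l + (t * b l) *\<^sub>R \<theta>)) \<le> 1}"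
      unfolding P_def by (intro polar_comb_image C ne)
    show meas: "P \<in> sets borel"
      unfolding P by (intro borel_closed closed_polar_sublevel C ne)
    have "{v. L v \<in> P} = {v. G (v, t * v $ i) \<le> 1}"
      by (simp add: P G_def M_def inner_add_right L_inner mult_ac)
    then have "emeasure lborel P = ennreal (1 / \<bar>\<theta> $ i\<bar>) * inverse (ennreal (h t))"
      using emeasure_lborel_coordinate_change[OF i meas] h(3)[of t] by (simp add: L_def)
    also have "\<dots> = inverse (ennreal (\<bar>\<theta> $ i\<bar> * h t))"
    proof (cases "h t = 0")
      case True
      then show ?thesis using i by (simp add: ennreal_mult_top)
    next
      case False
      then have "0 < h t" using h(2)[of t] by simp
      then show ?thesis using i by (simp add: inverse_ennreal field_simps flip: ennreal_mult)
    qed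
    finally show "emeasure lborel P = inverse (ennreal (\<bar>\<theta> $ i\<bar> * h t))" .
  qed (use h in auto)
  moreover have "convex_on UNIV (\<lambda>t. (\<bar>\<theta> $ i\<bar> * h t) powr r)"
    using h r by (intro convex_on_powr_nonneg convex_on_cmul) auto
  ultimately show ?thesis by simp
qed

section \<open>RS-movements as measurable shears\<close>

text \<open>The chord is parametrised from the hyperplane and not from \<open>x\<close>. All points
  of a line parallel to \<open>\<theta>\<close> thus share one fibre, in which \<open>x\<close> sits
  at \<open>x \<bullet> \<theta>\<close>.\<close>

definition fibre :: "'a::euclidean_space \<Rightarrow> 'a set \<Rightarrow> 'a \<Rightarrow> real set" where
  "fibre \<theta> S x = {s. perp_proj \<theta> x + s *\<^sub>R \<theta> \<in> S}"

text \<open>Divided by the length of the fibre this is the centroid, which follows a translation of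
  the chord exactly. Unlike an endpoint it is insensitive to null sets.\<close>

definition fibre_moment :: "'a::euclidean_space \<Rightarrow> 'a set \<Rightarrow> 'a \<Rightarrow> real" where
  "fibre_moment \<theta> S x = (\<integral>s. indicator (fibre \<theta> S x) s * s \<partial>lborel)"

lemma perp_proj_add_scaleR [simp]: "norm \<theta> = 1 \<Longrightarrow> perp_proj \<theta> (x + s *\<^sub>R \<theta>) = perp_proj \<theta> x"
  by (simp add: perp_proj_def algebra_simps norm_eq_1)

lemma perp_proj_idem [simp]: "norm \<theta> = 1 \<Longrightarrow> perp_proj \<theta> (perp_proj \<theta> x) = perp_proj \<theta> x"
  by (simp add: perp_proj_def algebra_simps norm_eq_1)

lemma fibre_add_scaleR: "norm \<theta> = 1 \<Longrightarrow> fibre \<theta> S (x + s *\<^sub>R \<theta>) = fibre \<theta> S x"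
  by (simp add: fibre_def)

lemma compact_fibre:
  assumes "norm \<theta> = 1" "compact S"
  shows "compact (fibre \<theta> S x)"
proof (rule compact_eq_bounded_closed[THEN iffD2], rule conjI)
  obtain B where B: "\<And>y. y \<in> S \<Longrightarrow> norm y \<le> B"
    using compact_imp_bounded[OF assms(2)] by (auto simp: bounded_iff)
  have "\<bar>s\<bar> \<le> B + norm (perp_proj \<theta> x)" if "s \<in> fibre \<theta> S x" for s
    using B[of "perp_proj \<theta> x + s *\<^sub>R \<theta>"] that assms(1)
      norm_triangle_ineq4[of "perp_proj \<theta> x + s *\<^sub>R \<theta>" "perp_proj \<theta> x"]
    by (auto simp: fibre_def)
  then show "bounded (fibre \<theta> S x)" by (auto simp: bounded_iff)
  have "fibre \<theta> S x = (\<lambda>s. perp_proj \<theta> x + s *\<^sub>R \<theta>) -` S" by (auto simp: fibre_def)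
  also have "closed \<dots>"
    using compact_imp_closed[OF assms(2)] by (intro continuous_closed_vimage) (auto intro!: continuous_intros)
  finally show "closed (fibre \<theta> S x)" .
qed

lemma borel_measurable_perp_proj [measurable]: "perp_proj \<theta> \<in> borel_measurable borel"
  unfolding perp_proj_def[abs_def] by (intro borel_measurable_continuous_onI continuous_intros)

lemma borel_measurable_fibre:
  assumes [measurable]: "S \<in> sets borel"
  shows "(\<lambda>x. measure lborel (fibre \<theta> S x)) \<in> borel_measurable borel"
    and "fibre_moment \<theta> S \<in> borel_measurable borel"
proof -
  have ind: "(\<lambda>(x, s). indicator (fibre \<theta> S x) s :: real) = (\<lambda>(x, s). indicator S (perp_proj \<theta> x + s *\<^sub>R \<theta>))"
    by (auto simp: fibre_def indicator_def fun_eq_iff)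
  have [measurable]: "(\<lambda>(x, s). indicator (fibre \<theta> S x) s :: real) \<in> borel_measurable (borel \<Otimes>\<^sub>M borel)"
    unfolding ind by measurable
  have "(\<lambda>x. measure lborel (fibre \<theta> S x)) = (\<lambda>x. \<integral>s. indicator (fibre \<theta> S x) s \<partial>lborel)"
    by simp
  also have "\<dots> \<in> borel_measurable borel" by measurable
  finally show "(\<lambda>x. measure lborel (fibre \<theta> S x)) \<in> borel_measurable borel" .
  show "fibre_moment \<theta> S \<in> borel_measurable borel"
    unfolding fibre_moment_def[abs_def] by measurable
qed

lemma measure_fibre_pos:
  assumes "norm \<theta> = 1" "compact S" "x \<in> interior S"
  shows "0 < measure lborel (fibre \<theta> S x)"
proof -
  obtain e where e: "0 < e" "cball x e \<subseteq> S"
    using assms(3) by (auto simp: mem_interior_cball)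
  have "{x \<bullet> \<theta> - e .. x \<bullet> \<theta> + e} \<subseteq> fibre \<theta> S x"
  proof
    fix s assume s: "s \<in> {x \<bullet> \<theta> - e .. x \<bullet> \<theta> + e}"
    have "x - (perp_proj \<theta> x + s *\<^sub>R \<theta>) = (x \<bullet> \<theta> - s) *\<^sub>R \<theta>"
      by (simp add: perp_proj_def algebra_simps)
    then have "dist x (perp_proj \<theta> x + s *\<^sub>R \<theta>) \<le> e"
      using s assms(1) by (auto simp: dist_norm)
    then show "s \<in> fibre \<theta> S x" using e by (auto simp: fibre_def)
  qed
  then have "measure lborel {x \<bullet> \<theta> - e .. x \<bullet> \<theta> + e} \<le> measure lborel (fibre \<theta> S x)"
    using compact_fibre[OF assms(1,2)]
    by (intro measure_mono_fmeasurable) (auto simp: fmeasurable_compact compact_imp_closed)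
  then show ?thesis using e by simp
qed

text \<open>Every translate of \<open>N\<close> is null, so the double integral over
  \<open>x\<close> and \<open>s\<close> of the indicator at \<open>x + s *\<^sub>R \<theta>\<close>
  vanishes. A translation of \<open>s\<close> by \<open>x \<bullet> \<theta>\<close> then moves the
  origin of the line to the hyperplane.\<close>

lemma AE_fibre_null:
  fixes N :: "'a::euclidean_space set"
  assumes \<theta>: "norm \<theta> = 1" and N: "N \<in> null_sets lborel"
  shows "AE x in lborel. AE s in lborel. s \<notin> fibre \<theta> N x"
proof -
  have [measurable]: "N \<in> sets borel" using N by auto
  have "(\<integral>\<^sup>+x. \<integral>\<^sup>+s. indicator N (x + s *\<^sub>R \<theta>) \<partial>lborel \<partial>lborel)
      = (\<integral>\<^sup>+s. \<integral>\<^sup>+x. indicator N (x + s *\<^sub>R \<theta>) \<partial>lborel \<partial>lborel)"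
    by (intro lborel_pair.Fubini'[symmetric]) (simp add: split_beta')
  also have "\<dots> = (\<integral>\<^sup>+(s::real). 0 \<partial>lborel)"
    using N by (intro nn_integral_cong) (simp add: nn_integral_lborel_translate null_setsD1)
  finally have "(\<integral>\<^sup>+x. \<integral>\<^sup>+s. indicator N (x + s *\<^sub>R \<theta>) \<partial>lborel \<partial>lborel) = 0" by simp
  then have "AE x in lborel. (\<integral>\<^sup>+s. indicator N (x + s *\<^sub>R \<theta>) \<partial>lborel) = 0"
    by (subst (asm) nn_integral_0_iff_AE) auto
  then show ?thesis
  proof eventually_elim
    case (elim x)
    have "(\<integral>\<^sup>+s. indicator N (perp_proj \<theta> x + s *\<^sub>R \<theta>) \<partial>lborel)
        = (\<integral>\<^sup>+s. indicator N (perp_proj \<theta> x + (s + x \<bullet> \<theta>) *\<^sub>R \<theta>) \<partial>lborel)"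
      by (intro nn_integral_lborel_translate[symmetric]) measurable
    also have "\<dots> = (\<integral>\<^sup>+s. indicator N (x + s *\<^sub>R \<theta>) \<partial>lborel)"
      by (intro nn_integral_cong arg_cong[where f = "indicator N"]) (simp add: perp_proj_def algebra_simps)
    finally have "(\<integral>\<^sup>+s. indicator N (perp_proj \<theta> x + s *\<^sub>R \<theta>) \<partial>lborel) = 0" using elim by simp
    then have "AE s in lborel. indicator N (perp_proj \<theta> x + s *\<^sub>R \<theta>) = (0::ennreal)"
      by (subst (asm) nn_integral_0_iff_AE) auto
    then show ?case
      by eventually_elim (auto simp: fibre_def indicator_def split: if_splits)
  qed
qed

text \<open>Substitution in the integrals for length and first moment. The displacement
  \<open>d\<close> can be read off as soon as the length is positive.\<close>

lemma fibre_shift: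
  assumes \<theta>: "norm \<theta> = 1" and S: "compact S" and R: "compact R"
    and ae: "AE s in lborel. s \<in> fibre \<theta> R x \<longleftrightarrow> s - d \<in> fibre \<theta> S x"
  shows "measure lborel (fibre \<theta> R x) = measure lborel (fibre \<theta> S x)"
    and "fibre_moment \<theta> R x = fibre_moment \<theta> S x + d * measure lborel (fibre \<theta> S x)"
proof -
  have S'[measurable]: "fibre \<theta> S x \<in> sets borel" and R'[measurable]: "fibre \<theta> R x \<in> sets borel"
    using compact_fibre[OF \<theta>] S R by (auto intro: borel_compact)
  have int: "integrable lborel (\<lambda>s. indicator (fibre \<theta> S x) s :: real)"
      "integrable lborel (\<lambda>s. indicator (fibre \<theta> S x) s * s :: real)"
    using borel_integrable_compact[OF compact_fibre[OF \<theta> S, of x], of "\<lambda>_. 1 :: real"]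
      borel_integrable_compact[OF compact_fibre[OF \<theta> S, of x], of "\<lambda>s. s"] by auto
  have "measure lborel (fibre \<theta> R x) = (\<integral>s. indicator (fibre \<theta> R x) s \<partial>lborel)" by simp
  also have "\<dots> = (\<integral>s. indicator (fibre \<theta> S x) (s - d) \<partial>lborel)"
    using ae by (intro integral_cong_AE) (auto simp: indicator_def elim!: eventually_mono)
  also have "\<dots> = (\<integral>s. indicator (fibre \<theta> S x) s \<partial>lborel)"
    using lborel_integral_real_affine[of 1 "\<lambda>s. indicator (fibre \<theta> S x) (s - d) :: real" d] by simp
  finally show "measure lborel (fibre \<theta> R x) = measure lborel (fibre \<theta> S x)" by simp
  have "fibre_moment \<theta> R x = (\<integral>s. indicator (fibre \<theta> S x) (s - d) * s \<partial>lborel)"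
    unfolding fibre_moment_def
    using ae by (intro integral_cong_AE) (auto simp: indicator_def elim!: eventually_mono)
  also have "\<dots> = (\<integral>s. indicator (fibre \<theta> S x) s * (d + s) \<partial>lborel)"
    using lborel_integral_real_affine[of 1 "\<lambda>s. indicator (fibre \<theta> S x) (s - d) * s :: real" d] by simp
  also have "\<dots> = (\<integral>s. indicator (fibre \<theta> S x) s * s + d * indicator (fibre \<theta> S x) s \<partial>lborel)"
    by (simp add: algebra_simps)
  also have "\<dots> = fibre_moment \<theta> S x + d * measure lborel (fibre \<theta> S x)"
    unfolding fibre_moment_def using int by (subst Bochner_Integration.integral_add) auto
  finally show "fibre_moment \<theta> R x = fibre_moment \<theta> S x + d * measure lborel (fibre \<theta> S x)" .
qed

text \<open>The displacement depends only on \<open>perp_proj\<close> and does not change it, so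
  each chord moves rigidly and no two chords mix.\<close>

lemma moved_chords_fibre:
  assumes "norm \<theta> = 1"
  shows "s \<in> fibre \<theta> (moved_chords \<theta> \<beta> L t) x \<longleftrightarrow> s - t * \<beta> (perp_proj \<theta> x) \<in> fibre \<theta> L x"
proof
  assume "s \<in> fibre \<theta> (moved_chords \<theta> \<beta> L t) x"
  then obtain y where y: "y \<in> L" "perp_proj \<theta> x + s *\<^sub>R \<theta> = y + (t * \<beta> (perp_proj \<theta> y)) *\<^sub>R \<theta>"
    by (auto simp: fibre_def moved_chords_def)
  from arg_cong[OF y(2), of "perp_proj \<theta>"] have "perp_proj \<theta> y = perp_proj \<theta> x"
    using assms by simp
  with y show "s - t * \<beta> (perp_proj \<theta> x) \<in> fibre \<theta> L x"
    by (simp add: fibre_def algebra_simps)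
next
  assume *: "s - t * \<beta> (perp_proj \<theta> x) \<in> fibre \<theta> L x"
  define y where "y = perp_proj \<theta> x + (s - t * \<beta> (perp_proj \<theta> x)) *\<^sub>R \<theta>"
  have "y \<in> L" "perp_proj \<theta> y = perp_proj \<theta> x"
    using * assms by (auto simp: fibre_def y_def)
  moreover have "perp_proj \<theta> x + s *\<^sub>R \<theta> = y + (t * \<beta> (perp_proj \<theta> x)) *\<^sub>R \<theta>"
    by (simp add: y_def algebra_simps)
  ultimately show "s \<in> fibre \<theta> (moved_chords \<theta> \<beta> L t) x"
    unfolding fibre_def moved_chords_def mem_Collect_eq by (intro image_eqI[of _ _ y]) auto
qed

lemma mem_iff_fibre: "x \<in> S \<longleftrightarrow> x \<bullet> \<theta> \<in> fibre \<theta> S x"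
  by (simp add: fibre_def perp_proj_def)

text \<open>The speed function is recovered almost everywhere from the first moments of the chords of
  \<open>K 0\<close> and \<open>K 1\<close>, which makes it Borel measurable.\<close>

lemma RS_movement_shear:
  fixes K :: "real \<Rightarrow> 'a::euclidean_space set"
  assumes RS: "RS_movement \<theta> \<beta> (K 0) (-1) 1 K"
    and neg: "\<And>t. t \<in> {-1..1} \<Longrightarrow> negligible (K t - moved_chords \<theta> \<beta> (K 0) t)"
    and body: "\<And>t. t \<in> {-1..1} \<Longrightarrow> convex_body (K t)"
  obtains b where "b \<in> borel_measurable borel" "\<And>x s. b (x + s *\<^sub>R \<theta>) = b x"
    and "\<And>t. t \<in> {-1..1} \<Longrightarrow> AE x in lborel. x + (t * b x) *\<^sub>R \<theta> \<in> K t \<longleftrightarrow> x \<in> K 0"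
proof -
  have \<theta>: "norm \<theta> = 1" and hull: "\<And>t. t \<in> {-1..1} \<Longrightarrow> K t = convex hull (moved_chords \<theta> \<beta> (K 0) t)"
    using RS unfolding RS_movement_def shadow_system_def moved_chords_def o_def by blast+
  have moved: "moved_chords \<theta> \<beta> (K 0) t \<subseteq> K t" if "t \<in> {-1..1}" for t
    using hull[OF that] hull_subset by metis
  have comp: "compact (K t)" and conv: "convex (K t)" if "t \<in> {-1..1}" for t
    using body[OF that] by (auto simp: convex_body_def)
  \<comment> \<open>The frontier is put into the exceptional set so that a point of
    \<open>K t\<close> outside it is interior; the chord through it then has positive length and its
    speed can be determined.\<close>
  have "\<exists>N. N \<in> null_sets lborel \<and> K t - moved_chords \<theta> \<beta> (K 0) t \<subseteq> N \<and> frontier (K t) \<subseteq> N"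
    if "t \<in> {-1..1}" for t
  proof -
    have "negligible ((K t - moved_chords \<theta> \<beta> (K 0) t) \<union> frontier (K t))"
      using neg[OF that] conv[OF that] by (intro negligible_Un negligible_convex_frontier)
    then show ?thesis by (auto simp: negligible_iff_null_sets null_sets_completion_iff2)
  qed
  then obtain N where N: "\<And>t. t \<in> {-1..1} \<Longrightarrow> N t \<in> null_sets lborel"
    "\<And>t. t \<in> {-1..1} \<Longrightarrow> K t - moved_chords \<theta> \<beta> (K 0) t \<subseteq> N t"
    "\<And>t. t \<in> {-1..1} \<Longrightarrow> frontier (K t) \<subseteq> N t" by metis
  \<comment> \<open>The displacement of the centroid between times 0 and 1. On chords of length zero
    the division yields the default 0.\<close>
  define b where "b x = (fibre_moment \<theta> (K 1) x - fibre_moment \<theta> (K 0) x) / measure lborel (fibre \<theta> (K 0) x)" for x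
  have [measurable]: "K 0 \<in> sets borel" "K 1 \<in> sets borel"
    using comp[of 0] comp[of 1] by (auto intro: borel_compact)
  have b[measurable]: "b \<in> borel_measurable borel"
    unfolding b_def[abs_def] using borel_measurable_fibre by measurable
  have b_inv: "b (x + s *\<^sub>R \<theta>) = b x" for x s
    by (simp add: b_def fibre_moment_def fibre_add_scaleR[OF \<theta>])
  have shift: "AE x in lborel. AE s in lborel. s \<in> fibre \<theta> (K t) x \<longleftrightarrow> s - t * \<beta> (perp_proj \<theta> x) \<in> fibre \<theta> (K 0) x"
    if t: "t \<in> {-1..1}" for t
    using AE_fibre_null[OF \<theta> N(1)[OF t]]
  proof eventually_elim
    case (elim x)
    then show ?case
    proof eventually_elim
      case (elim s)
      have "s \<in> fibre \<theta> (K t) x \<longleftrightarrow> s \<in> fibre \<theta> (moved_chords \<theta> \<beta> (K 0) t) x"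
        using elim N(2)[OF t] moved[OF t] by (auto simp: fibre_def)
      then show ?case using moved_chords_fibre[OF \<theta>] by blast
    qed
  qed
  have "AE x in lborel. x + (t * b x) *\<^sub>R \<theta> \<in> K t \<longleftrightarrow> x \<in> K 0" if t: "t \<in> {-1..1}" for t
  proof -
    have inv: "t * b (x + s *\<^sub>R \<theta>) = t * b x" for x s by (simp add: b_inv)
    \<comment> \<open>The shear by \<open>b\<close> preserves Lebesgue measure, so the image of
      almost every point avoids the null set \<open>N t\<close>.\<close>
    have "AE x in distr lborel borel (\<lambda>x. x + (t * b x) *\<^sub>R \<theta>). x \<notin> N t"
      using N(1)[OF t] by (subst distr_lborel_shear[OF _ inv]) (auto intro: AE_not_in)
    then have ae_T: "AE x in lborel. x + (t * b x) *\<^sub>R \<theta> \<notin> N t"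
      using N(1)[OF t] by (subst (asm) AE_distr_iff) auto
    have "AE x in lborel. x \<notin> N 0" using N(1)[of 0] by (intro AE_not_in) auto
    with ae_T shift[OF t] shift[of 1, simplified] show ?thesis
    proof eventually_elim
      case (elim x)
      have t01: "(0::real) \<in> {-1..1}" "(1::real) \<in> {-1..1}" by auto
      \<comment> \<open>For the converse implication only the chord of \<open>K t\<close> is known
        to have positive length; equality of lengths transfers this to \<open>K 0\<close>.\<close>
      have len: "measure lborel (fibre \<theta> (K t) x) = measure lborel (fibre \<theta> (K 0) x)"
        using fibre_shift(1)[OF \<theta> comp[OF t01(1)] comp[OF t] elim(2)] .
      have speed: "b x = \<beta> (perp_proj \<theta> x)" if "0 < measure lborel (fibre \<theta> (K 0) x)"
        using fibre_shift(2)[OF \<theta> comp[OF t01(1)] comp[OF t01(2)], of x "\<beta> (perp_proj \<theta> x)"] elim(3) that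
        by (simp add: b_def)
      have T_iff: "x + (t * b x) *\<^sub>R \<theta> \<in> moved_chords \<theta> \<beta> (K 0) t \<longleftrightarrow> x \<in> K 0"
        if "b x = \<beta> (perp_proj \<theta> x)"
        using moved_chords_fibre[OF \<theta>, of "(x + (t * b x) *\<^sub>R \<theta>) \<bullet> \<theta>" \<beta> "K 0" t x] that \<theta>
          mem_iff_fibre[of x "K 0" \<theta>] mem_iff_fibre[of "x + (t * b x) *\<^sub>R \<theta>" "moved_chords \<theta> \<beta> (K 0) t" \<theta>]
        by (simp add: fibre_add_scaleR inner_add_left norm_eq_1)
      show ?case
      proof
        assume "x \<in> K 0"
        then have "x \<in> interior (K 0)"
          using elim(4) N(3)[OF t01(1)] closure_subset[of "K 0"] by (auto simp: frontier_def)
        then have "b x = \<beta> (perp_proj \<theta> x)"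
          using measure_fibre_pos[OF \<theta> comp[OF t01(1)]] speed by blast
        then show "x + (t * b x) *\<^sub>R \<theta> \<in> K t"
          using T_iff \<open>x \<in> K 0\<close> moved[OF t] by blast
      next
        assume T: "x + (t * b x) *\<^sub>R \<theta> \<in> K t"
        then have "x + (t * b x) *\<^sub>R \<theta> \<in> interior (K t)"
          using elim(1) N(3)[OF t] closure_subset[of "K t"] by (auto simp: frontier_def)
        then have "0 < measure lborel (fibre \<theta> (K 0) x)"
          using measure_fibre_pos[OF \<theta> comp[OF t]] len by (metis fibre_add_scaleR[OF \<theta>])
        then have "b x = \<beta> (perp_proj \<theta> x)" by (rule speed)
        moreover have "x + (t * b x) *\<^sub>R \<theta> \<in> moved_chords \<theta> \<beta> (K 0) t"
          using T elim(1) N(2)[OF t] by blast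
        ultimately show "x \<in> K 0" using T_iff by blast
      qed
    qed
  qed
  then show thesis using that b b_inv by blast
qed

section \<open>Tuples of points\<close>

lemma distr_PiM_componentwise:
  fixes T :: "'a::euclidean_space \<Rightarrow> 'a"
  assumes T[measurable]: "T \<in> borel_measurable borel" and inv: "distr lborel borel T = lborel"
  shows "distr (\<Pi>\<^sub>M i\<in>(UNIV :: 'm::finite set). lborel) (\<Pi>\<^sub>M i\<in>UNIV. lborel) (\<lambda>x i. T (x i))
      = (\<Pi>\<^sub>M i\<in>UNIV. lborel)"
proof -
  interpret product_sigma_finite "\<lambda>_ :: 'm. lborel :: 'a measure" by standard
  show ?thesis
  proof (rule PiM_eqI)
    fix A :: "'m \<Rightarrow> 'a set" assume A: "\<And>i. i \<in> UNIV \<Longrightarrow> A i \<in> sets lborel"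
    have meas: "(\<lambda>x i. T (x i)) \<in> measurable (\<Pi>\<^sub>M i\<in>(UNIV :: 'm set). lborel) (\<Pi>\<^sub>M i\<in>UNIV. lborel)"
      by (intro measurable_PiM_single') (auto simp: space_PiM)
    have "(\<lambda>x i. T (x i)) -` Pi\<^sub>E UNIV A \<inter> space (\<Pi>\<^sub>M i\<in>UNIV. lborel) = (\<Pi>\<^sub>E i\<in>UNIV. T -` A i)"
      by (auto simp: space_PiM)
    moreover have "T -` A i \<in> sets lborel" for i
      using A measurable_sets_borel[OF T, of "A i"] by simp
    moreover have "emeasure lborel (T -` A i) = emeasure lborel (A i)" for i
      using A inv emeasure_distr[of T lborel borel "A i"] by simp
    ultimately show "emeasure (distr (\<Pi>\<^sub>M i\<in>UNIV. lborel) (\<Pi>\<^sub>M i\<in>UNIV. lborel) (\<lambda>x i. T (x i))) (Pi\<^sub>E UNIV A)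
        = (\<Prod>i\<in>UNIV. emeasure lborel (A i))"
      using A by (subst emeasure_distr[OF meas]) (auto simp: emeasure_PiM sets_PiM_I_finite)
  qed simp_all
qed

lemma AE_PiM_lborel_component:
  assumes "AE x in (lborel :: 'a::euclidean_space measure). P x"
  shows "AE x in (\<Pi>\<^sub>M i\<in>(UNIV :: 'm::finite set). lborel). \<forall>i. P (x i)"
proof -
  interpret product_sigma_finite "\<lambda>_ :: 'm. lborel :: 'a measure" by standard
  obtain N where N: "{x. \<not> P x} \<subseteq> N" "N \<in> sets lborel" "emeasure lborel N = 0"
    using assms by (auto elim: AE_E)
  have "AE x in (\<Pi>\<^sub>M i\<in>(UNIV :: 'm set). lborel). P (x i)" for i
  proof (rule AE_I)
    show "{x \<in> space (\<Pi>\<^sub>M i\<in>(UNIV :: 'm set). lborel). \<not> P (x i)}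
        \<subseteq> (\<Pi>\<^sub>E j\<in>UNIV. if j = i then N else UNIV)"
      using N(1) by (auto simp: space_PiM)
    show "emeasure (\<Pi>\<^sub>M i\<in>(UNIV :: 'm set). lborel) (\<Pi>\<^sub>E j\<in>UNIV. if j = i then N else UNIV) = 0"
      using N by (subst emeasure_PiM) (auto intro!: prod_zero)
    show "(\<Pi>\<^sub>E j\<in>UNIV. if j = i then N else UNIV) \<in> sets (\<Pi>\<^sub>M i\<in>(UNIV :: 'm set). lborel)"
      using N by (intro sets_PiM_I_finite) auto
  qed
  then show ?thesis by (simp add: AE_all_countable)
qed

section \<open>Measurability and boundedness of the integrand\<close>

lemma borel_measurable_vol_neg_powr_polar:
  fixes C :: "(real ^ 'm) set"
  assumes C: "compact C" "C \<noteq> {}"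
  shows "(\<lambda>x :: 'm \<Rightarrow> 'a::euclidean_space. vol_neg_powr r (polar (comb_image x C)))
      \<in> borel_measurable (\<Pi>\<^sub>M i\<in>UNIV. lborel)"
proof -
  define E where "E x = emeasure lborel (polar (comb_image x C))" for x :: "'m \<Rightarrow> 'a"
  have [measurable]: "support_fn C \<in> borel_measurable borel"
    by (intro borel_measurable_convex convex_on_support_fn C)
  have [measurable]: "(\<lambda>z. \<chi> i. snd z \<bullet> fst z i) \<in> borel_measurable ((\<Pi>\<^sub>M i\<in>(UNIV :: 'm set). lborel) \<Otimes>\<^sub>M (lborel :: 'a measure))"
  proof (rule borel_measurable_vec_lambda)
    fix i
    have [measurable]: "(\<lambda>z. fst z i) \<in> borel_measurable ((\<Pi>\<^sub>M i\<in>(UNIV :: 'm set). lborel :: 'a measure) \<Otimes>\<^sub>M (lborel :: 'a measure))"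
      using measurable_compose[OF measurable_fst measurable_component_singleton[of i UNIV "\<lambda>_. lborel :: 'a measure"]] by simp
    show "(\<lambda>z. snd z \<bullet> fst z i) \<in> borel_measurable ((\<Pi>\<^sub>M i\<in>(UNIV :: 'm set). lborel) \<Otimes>\<^sub>M (lborel :: 'a measure))"
      by measurable
  qed
  have closed: "closed (polar (comb_image x C))" for x :: "'m \<Rightarrow> 'a"
    unfolding polar_comb_image[OF C] by (intro closed_polar_sublevel C)
  have "E x = (\<integral>\<^sup>+w. indicator {z. support_fn C (\<chi> i. snd z \<bullet> fst z i) \<le> 1} (x, w) \<partial>lborel)" for x
  proof -
    have "E x = (\<integral>\<^sup>+w. indicator (polar (comb_image x C)) w \<partial>lborel)"
      unfolding E_def using closed by simp
    then show ?thesis by (simp add: polar_comb_image[OF C] indicator_def)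
  qed
  then have "E = (\<lambda>x. \<integral>\<^sup>+w. indicator {z. support_fn C (\<chi> i. snd z \<bullet> fst z i) \<le> 1} (x, w) \<partial>lborel)" by blast
  also have "\<dots> \<in> borel_measurable (\<Pi>\<^sub>M i\<in>UNIV. lborel)"
    unfolding indicator_def by measurable
  finally have [measurable]: "E \<in> borel_measurable (\<Pi>\<^sub>M i\<in>UNIV. lborel)" .
  have "vol_neg_powr r (polar (comb_image x C)) = (if E x = \<infinity> then 0 else enn2real (E x) powr (- r))" for x
    using closed[of x] by (simp add: vol_neg_powr_def E_def measure_def)
  then show ?thesis by simp
qed

lemma vol_neg_powr_nonneg: "0 \<le> vol_neg_powr r S"
  by (simp add: vol_neg_powr_def)

text \<open>Points in a bounded set keep the image of \<open>C\<close> inside a ball of fixed radius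
  \<open>Q\<close>, so its polar contains the ball of radius \<open>1 / Q\<close> and its volume is
  bounded below. The summand 1 in \<open>Q\<close> makes this radius well defined.\<close>

lemma vol_neg_powr_polar_bounded:
  fixes C :: "(real ^ 'm) set" and K :: "'a::euclidean_space set"
  assumes C: "compact C" "C \<noteq> {}" and K: "bounded K" and r: "0 \<le> r"
  obtains B where "\<And>x. (\<And>i. x i \<in> K) \<Longrightarrow> vol_neg_powr r (polar (comb_image x C)) \<le> B"
proof -
  obtain k where k: "\<And>y. y \<in> K \<Longrightarrow> norm y \<le> k" using K by (auto simp: bounded_iff)
  obtain c where c: "\<And>y. y \<in> C \<Longrightarrow> norm y \<le> c" using compact_imp_bounded[OF C(1)] by (auto simp: bounded_iff)
  define Q where "Q = 1 + real CARD('m) * (\<bar>c\<bar> * \<bar>k\<bar>)"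
  have Q: "0 < Q" by (auto simp: Q_def intro: add_pos_nonneg)
  have "vol_neg_powr r (polar (comb_image x C)) \<le> measure lborel (ball (0 :: 'a) (1 / Q)) powr (- r)"
    if x: "\<And>i. x i \<in> K" for x
  proof -
    define P where "P = polar (comb_image x C)"
    have closed: "closed P"
      unfolding P_def polar_comb_image[OF C] by (intro closed_polar_sublevel C)
    have "norm v \<le> Q" if "v \<in> comb_image x C" for v
    proof -
      obtain d where d: "d \<in> C" "v = (\<Sum>i\<in>UNIV. (d $ i) *\<^sub>R x i)"
        using \<open>v \<in> comb_image x C\<close> by (auto simp: comb_image_def)
      have "norm v \<le> (\<Sum>i\<in>(UNIV :: 'm set). \<bar>c\<bar> * \<bar>k\<bar>)"
        unfolding d(2)
      proof (intro order_trans[OF norm_sum] sum_mono)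
        fix i
        have "\<bar>d $ i\<bar> \<le> \<bar>c\<bar>" "norm (x i) \<le> \<bar>k\<bar>"
          using c[OF d(1)] k[OF x[of i]] component_le_norm_cart[of d i] by auto
        then show "norm ((d $ i) *\<^sub>R x i) \<le> \<bar>c\<bar> * \<bar>k\<bar>"
          by (simp add: mult_mono)
      qed
      then show ?thesis by (simp add: Q_def)
    qed
    then have "w \<bullet> v \<le> 1" if "norm w < 1 / Q" "v \<in> comb_image x C" for w v
      using that Q norm_cauchy_schwarz[of w v] mult_mono[of "norm w" "1 / Q" "norm v" Q] by force
    then have ball: "ball 0 (1 / Q) \<subseteq> P" by (auto simp: P_def polar_def)
    show ?thesis
    proof (cases "emeasure lborel P = \<infinity>")
      case True
      then show ?thesis using closed by (simp add: P_def[symmetric] vol_neg_powr_def)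
    next
      case False
      then have "P \<in> fmeasurable lborel" using closed by (auto simp: fmeasurable_def less_top)
      then have "measure lborel (ball (0 :: 'a) (1 / Q)) \<le> measure lborel P"
        using ball by (intro measure_mono_fmeasurable) auto
      moreover have "0 < measure lborel (ball (0 :: 'a) (1 / Q))"
        using content_ball_pos[of "1 / Q" 0] Q by simp
      ultimately have "measure lborel P powr (- r) \<le> measure lborel (ball (0 :: 'a) (1 / Q)) powr (- r)"
        using r by (intro powr_mono2') auto
      then show ?thesis using False closed by (simp add: P_def[symmetric] vol_neg_powr_def)
    qed
  qed
  then show thesis using that by blast
qed

section \<open>Convexity of \<open>W\<close> along the movement\<close>

theorem theorem3p4:
  fixes C :: "(real ^ 'm) set"
    and K :: "real \<Rightarrow> (real ^ 'n) set"
    and \<theta> :: "real ^ 'n"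
    and \<beta> :: "real ^ 'n \<Rightarrow> real"
    and r :: real
  assumes "CARD('n) \<le> CARD('m)"
    and "1 \<le> r"
    and "convex_body C" and "centrally_symmetric C" and "0 \<in> interior C"
    and "RS_movement \<theta> \<beta> (K 0) (-1) 1 K"
    and "\<And>t. t \<in> {-1..1} \<Longrightarrow> negligible (K t - moved_chords \<theta> \<beta> (K 0) t)"
    and "\<And>t. t \<in> {-1..1} \<Longrightarrow> convex_body (K t)"
    and "\<And>t. t \<in> {-1..1} \<Longrightarrow> centrally_symmetric (K t)"
    and "\<And>t. t \<in> {-1..1} \<Longrightarrow> 0 \<in> interior (K t)"
  shows "convex_on {-1..1} (\<lambda>t. W r (K t) C)"
proof -
  have C: "compact C" "0 \<in> C" "C \<noteq> {}"
    using \<open>convex_body C\<close> \<open>0 \<in> interior C\<close> interior_subset by (auto simp: convex_body_def)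
  have comp: "compact (K t)" if "t \<in> {-1..1}" for t
    using assms(8)[OF that] by (simp add: convex_body_def)
  have "norm \<theta> = 1"
    using assms(6) unfolding RS_movement_def shadow_system_def by blast
  then have "\<theta> \<noteq> 0" by auto
  obtain b where b: "b \<in> borel_measurable borel" and b_inv: "\<And>x s. b (x + s *\<^sub>R \<theta>) = b x"
    and ae: "\<And>t. t \<in> {-1..1} \<Longrightarrow> AE x in lborel. x + (t * b x) *\<^sub>R \<theta> \<in> K t \<longleftrightarrow> x \<in> K 0"
    using RS_movement_shear[OF assms(6,7,8)] by blast
  note [measurable] = b
  define F where "F x = vol_neg_powr r (polar (comb_image x C))" for x :: "'m \<Rightarrow> real ^ 'n"
  define M where "M = (\<Pi>\<^sub>M i\<in>(UNIV :: 'm set). lborel :: (real ^ 'n) measure)"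
  define T where "T t x = x + (t * b x) *\<^sub>R \<theta>" for t x
  have [measurable]: "T t \<in> borel_measurable borel" for t unfolding T_def[abs_def] by measurable
  have distr_T: "distr lborel borel (T t) = lborel" for t
    unfolding T_def by (rule distr_lborel_shear) (simp_all add: b_inv)
  have distr_M: "distr M M (\<lambda>x i. T t (x i)) = M" for t
    unfolding M_def by (rule distr_PiM_componentwise[OF _ distr_T]) measurable
  have T_M[measurable]: "(\<lambda>x i. T t (x i)) \<in> measurable M M" for t
    unfolding M_def by (intro measurable_PiM_single') (auto simp: space_PiM)
  have F[measurable]: "F \<in> borel_measurable M"
    unfolding F_def M_def by (intro borel_measurable_vol_neg_powr_polar C)
  define Q where "Q t = {x :: 'm \<Rightarrow> real ^ 'n. \<forall>i. x i \<in> K t}" for t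
  have Q_PiE: "Q t = (\<Pi>\<^sub>E i\<in>(UNIV :: 'm set). K t)" for t by (auto simp: Q_def)
  have Q[measurable]: "Q t \<in> sets M" if "t \<in> {-1..1}" for t
    unfolding Q_PiE M_def using comp[OF that] by (intro sets_PiM_I_finite) (auto intro: borel_compact)
  interpret P: product_sigma_finite "\<lambda>_ :: 'm. lborel :: (real ^ 'n) measure" by standard
  \<comment> \<open>Monotonicity and additivity of the Bochner integral require integrability, since
    a function that is not integrable has integral 0 by default.\<close>
  have integrable: "integrable M (\<lambda>x. indicator (Q t) x * F x)" if t: "t \<in> {-1..1}" for t
  proof -
    obtain B where B: "\<And>x. (\<And>i. x i \<in> K t) \<Longrightarrow> F x \<le> B"
      using vol_neg_powr_polar_bounded[OF C(1,3) compact_imp_bounded[OF comp[OF t]], of r] \<open>1 \<le> r\<close>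
      unfolding F_def by auto
    have "emeasure M (Q t) = (\<Prod>i\<in>(UNIV :: 'm set). emeasure lborel (K t))"
      unfolding M_def Q_PiE using comp[OF t] by (intro P.emeasure_PiM) (auto intro: borel_compact)
    also have "\<dots> < \<infinity>"
      using emeasure_compact_finite[OF comp[OF t]] by (simp add: power_less_top_ennreal less_top)
    finally have finite: "emeasure M (Q t) < \<infinity>" .
    have "norm (F x) \<le> B" if "x \<in> Q t" for x
    proof -
      have "0 \<le> F x" by (simp add: F_def vol_neg_powr_nonneg)
      moreover have "F x \<le> B" using that by (intro B) (simp add: Q_def)
      ultimately show ?thesis by simp
    qed
    then have "AE x in M. x \<in> Q t \<longrightarrow> norm (F x) \<le> B" by simp
    from integrableI_bounded_set_indicator[OF Q[OF t] F finite this] show ?thesis by simp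
  qed
  have ae_Q: "AE x in M. (\<lambda>i. T t (x i)) \<in> Q t \<longleftrightarrow> x \<in> Q 0" if t: "t \<in> {-1..1}" for t
    using AE_PiM_lborel_component[OF ae[OF t], where 'm = 'm] unfolding M_def[symmetric]
    by eventually_elim (simp add: Q_def T_def)
  have t0: "0 \<in> {-1..1::real}" by simp
  have pulled: "integrable M (\<lambda>x. indicator (Q 0) x * F (\<lambda>i. T t (x i)))"
      "(\<integral>x. indicator (Q t) x * F x \<partial>M) = (\<integral>x. indicator (Q 0) x * F (\<lambda>i. T t (x i)) \<partial>M)"
    if t: "t \<in> {-1..1}" for t
  proof -
    have meas: "(\<lambda>x. indicator (Q t) x * F x) \<in> borel_measurable M"
      using Q[OF t] by measurable
    have cong: "AE x in M. indicator (Q t) (\<lambda>i. T t (x i)) * F (\<lambda>i. T t (x i))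
        = indicator (Q 0) x * F (\<lambda>i. T t (x i))"
      using ae_Q[OF t] by eventually_elim (simp add: indicator_def)
    have meas0: "(\<lambda>x. indicator (Q 0) x * F (\<lambda>i. T t (x i))) \<in> borel_measurable M"
      using Q[OF t0] by measurable
    have measT: "(\<lambda>x. indicator (Q t) (\<lambda>i. T t (x i)) * F (\<lambda>i. T t (x i))) \<in> borel_measurable M"
      using measurable_compose[OF T_M meas] .
    have "integrable M (\<lambda>x. indicator (Q t) (\<lambda>i. T t (x i)) * F (\<lambda>i. T t (x i)))"
      using integrable_distr_eq[OF T_M[of t] meas] integrable[OF t] by (simp add: distr_M)
    then show "integrable M (\<lambda>x. indicator (Q 0) x * F (\<lambda>i. T t (x i)))"
      using integrable_cong_AE[OF measT meas0 cong] by simp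
    have "(\<integral>x. indicator (Q t) x * F x \<partial>M)
        = (\<integral>x. indicator (Q t) (\<lambda>i. T t (x i)) * F (\<lambda>i. T t (x i)) \<partial>M)"
      using integral_distr[OF T_M[of t] meas] by (simp add: distr_M)
    also have "\<dots> = (\<integral>x. indicator (Q 0) x * F (\<lambda>i. T t (x i)) \<partial>M)"
      by (rule integral_cong_AE[OF measT meas0 cong])
    finally show "(\<integral>x. indicator (Q t) x * F x \<partial>M) = (\<integral>x. indicator (Q 0) x * F (\<lambda>i. T t (x i)) \<partial>M)" .
  qed
  \<comment> \<open>Constant volume makes the normalising factor of \<open>W\<close> independent of
    \<open>t\<close>, so only the integral has to be convex.\<close>
  have vol: "measure lebesgue (K t) = measure lebesgue (K 0)" if t: "t \<in> {-1..1}" for t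
  proof -
    have [measurable]: "K t \<in> sets borel" "K 0 \<in> sets borel"
      using comp[OF t] comp[OF t0] by (auto intro: borel_compact)
    have "emeasure lborel (K t) = emeasure lborel (T t -` K t)"
      using emeasure_distr[of "T t" lborel borel "K t"] by (simp add: distr_T)
    also have "\<dots> = emeasure lborel (K 0)"
      using ae[OF t] measurable_sets_borel[of "T t" borel "K t"]
      by (intro emeasure_eq_AE) (auto simp: T_def)
    finally show ?thesis by (simp add: measure_def)
  qed
  define c where "c = 1 / measure lebesgue (K 0) powr (real CARD('m) + r)"
  have W: "W r (K t) C = c * (\<integral>x. indicator (Q 0) x * F (\<lambda>i. T t (x i)) \<partial>M)" if t: "t \<in> {-1..1}" for t
    using pulled(2)[OF t] vol[OF t]
    by (simp add: W_def set_lebesgue_integral_def F_def M_def Q_def c_def)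
  \<comment> \<open>For a fixed tuple \<open>x\<close>, the points \<open>T t (x i)\<close> move
    along \<open>\<theta>\<close> with the constant speeds \<open>b (x i)\<close>.\<close>
  have F_convex: "F (\<lambda>i. T ((1 - u) * s + u * t) (x i))
      \<le> (1 - u) * F (\<lambda>i. T s (x i)) + u * F (\<lambda>i. T t (x i))" if "0 \<le> u" "u \<le> 1" for u s t x
    using convex_onD[OF vol_neg_powr_polar_shadow_convex[OF C(1,2) assms(4) \<open>\<theta> \<noteq> 0\<close> \<open>1 \<le> r\<close>, of x "\<lambda>i. b (x i)"],
        of u s t] that
    by (simp add: F_def T_def)
  show ?thesis
  proof (rule convex_onI)
    fix u s t :: real
    assume u: "0 < u" "u < 1" and st: "s \<in> {-1..1}" "t \<in> {-1..1}"
    have z: "(1 - u) *\<^sub>R s + u *\<^sub>R t \<in> {-1..1}"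
      using convexD_alt[OF convex_real_interval(5) st, of u] u by simp
    have "(\<integral>x. indicator (Q 0) x * F (\<lambda>i. T ((1 - u) * s + u * t) (x i)) \<partial>M)
        \<le> (\<integral>x. (1 - u) * (indicator (Q 0) x * F (\<lambda>i. T s (x i))) + u * (indicator (Q 0) x * F (\<lambda>i. T t (x i))) \<partial>M)"
    proof (rule integral_mono)
      fix x
      show "indicator (Q 0) x * F (\<lambda>i. T ((1 - u) * s + u * t) (x i))
          \<le> (1 - u) * (indicator (Q 0) x * F (\<lambda>i. T s (x i))) + u * (indicator (Q 0) x * F (\<lambda>i. T t (x i)))"
        using F_convex[of u s t x] u by (simp add: indicator_def)
    qed (use pulled(1) st z in auto)
    also have "\<dots> = (1 - u) * (\<integral>x. indicator (Q 0) x * F (\<lambda>i. T s (x i)) \<partial>M)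
        + u * (\<integral>x. indicator (Q 0) x * F (\<lambda>i. T t (x i)) \<partial>M)"
      using pulled(1) st by (subst Bochner_Integration.integral_add) auto
    finally have "c * (\<integral>x. indicator (Q 0) x * F (\<lambda>i. T ((1 - u) * s + u * t) (x i)) \<partial>M)
        \<le> c * ((1 - u) * (\<integral>x. indicator (Q 0) x * F (\<lambda>i. T s (x i)) \<partial>M)
            + u * (\<integral>x. indicator (Q 0) x * F (\<lambda>i. T t (x i)) \<partial>M))"
      by (intro mult_left_mono) (auto simp: c_def)
    then show "W r (K ((1 - u) *\<^sub>R s + u *\<^sub>R t)) C \<le> (1 - u) * W r (K s) C + u * W r (K t) C"
      unfolding W[OF z] W[OF st(1)] W[OF st(2)] by (simp add: distrib_left mult.left_commute)
  qed simp
qed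

end
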